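(* Let $K$ be an algebraically closed field with characteristic exponent $p$, and let $d$ be a nonnegative integer that is not of the form $c\cdot p^k$ with $c\in\{0,1,2\}$ and $k\in\mathbb{Z}_{\ge 0}$. For an $n$-dimensional $K$-vector space $V$, the generic symmetric border subrank of $S^dV$ is $\mathcal{O}(n^{1/(d-1)})$ as $n\to\infty$ (with $d$ and $K$ fixed).
   Context: The characteristic exponent of $K$ is $1$ if $\operatorname{char}K=0$ and $\operatorname{char}K$ otherwise. $S^dV$ is the $d$-th symmetric power of $V$ (quotient of $V^{\otimes d}$ by the span of all $T-\sigma(T)$, $\sigma\in S_d$). A linear map $\varphi:V\to W$ acts by $\varphi(v_1\cdots v_d)=(\varphi v_1)\cdots(\varphi v_d)$. The $r$-th unit tensor is $I_r=e_1^d+\dots+e_r^d\in S^dK^r$. The symmetric border subrank of $f\in S^dV$ is \[\underline{Q}_s(f)=\max\{r\mid I_r\in\overline{\{\varphi f\mid \varphi\in\operatorname{Hom}(V,K^r)\}}\},\] with Zariski closure in $S^dK^r$. For each $r$ the set of $f\in S^dV$ with $\underline{Q}_s(f)=r$ is constructible; the generic symmetric border subrank of $S^dV$ is the unique $r$ for which this set is Zariski-dense in $S^dV$. *)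

theory Defs
  imports
    "HOL-Library.Function_Algebras"
    "HOL-Library.Landau_Symbols"
    "HOL-Computational_Algebra.Computational_Algebra"
    "HOL-Combinatorics.Permutations"
    "Jordan_Normal_Form.Matrix"
begin

definition char_exponent :: "'a::semiring_1 itself \<Rightarrow> nat"
  where "char_exponent _ = (if CHAR('a) = 0 then 1 else CHAR('a))"

text \<open>
  The model of an \<open>n\<close>-dimensional space is \<open>K\<^sup>n\<close>. A tensor of order \<open>d\<close> over \<open>K\<^sup>n\<close> is the family of
  its coordinates: \<open>T [i\<^sub>1, \<dots>, i\<^sub>d]\<close> is the coefficient of \<open>e\<^bsub>i\<^sub>1\<^esub> \<otimes> \<dots> \<otimes> e\<^bsub>i\<^sub>d\<^esub>\<close>, with
  \<open>0 \<le> i\<^sub>1, \<dots>, i\<^sub>d < n\<close>, and \<open>T\<close> is zero on all other lists.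
\<close>

type_synonym 'a tensor = "nat list \<Rightarrow> 'a"

definition tensor_index :: "nat \<Rightarrow> nat \<Rightarrow> nat list set"
  where "tensor_index n d = {is. length is = d \<and> set is \<subseteq> {..<n}}"

definition tensors :: "nat \<Rightarrow> nat \<Rightarrow> 'a::zero tensor set"
  where "tensors n d = {T. \<forall>is. is \<notin> tensor_index n d \<longrightarrow> T is = 0}"

definition tensor_scale :: "'a::times \<Rightarrow> 'a tensor \<Rightarrow> 'a tensor"
  where "tensor_scale c T = (\<lambda>is. c * T is)"

interpretation tensor: vector_space "tensor_scale :: 'a::field \<Rightarrow> 'a tensor \<Rightarrow> 'a tensor"
  by unfold_locales (auto simp: tensor_scale_def fun_eq_iff algebra_simps)

definition pure_tensor :: "'a::comm_semiring_1 vec list \<Rightarrow> 'a tensor"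
  where "pure_tensor vs = (\<lambda>is. if list_all2 (\<lambda>i v. i < dim_vec v) is vs
           then \<Prod>k<length vs. (vs ! k) $ (is ! k) else 0)"

definition permute_tensor :: "(nat \<Rightarrow> nat) \<Rightarrow> 'a tensor \<Rightarrow> 'a tensor"
  where "permute_tensor \<sigma> T = (\<lambda>is. T (permute_list \<sigma> is))"

definition sym_relations :: "nat \<Rightarrow> nat \<Rightarrow> 'a::field tensor set"
  where "sym_relations n d =
           tensor.span {T - permute_tensor \<sigma> T | T \<sigma>. T \<in> tensors n d \<and> \<sigma> permutes {..<d}}"

definition sym_equiv :: "nat \<Rightarrow> nat \<Rightarrow> ('a::field tensor \<times> 'a tensor) set"
  where "sym_equiv n d = {(S, T). S \<in> tensors n d \<and> T \<in> tensors n d \<and> S - T \<in> sym_relations n d}"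

text \<open>The symmetric power \<open>S\<^sup>d K\<^sup>n\<close>; its elements are the cosets of \<^const>\<open>sym_relations\<close>.\<close>

definition sym_power :: "nat \<Rightarrow> nat \<Rightarrow> 'a::field tensor set set"
  where "sym_power n d = tensors n d // sym_equiv n d"

definition sym_class :: "nat \<Rightarrow> nat \<Rightarrow> 'a::field tensor \<Rightarrow> 'a tensor set"
  where "sym_class n d T = sym_equiv n d `` {T}"

text \<open>\<open>tensor_map d A\<close> is the \<open>d\<close>-fold tensor power of the linear map with matrix \<open>A\<close>.\<close>

definition tensor_map :: "nat \<Rightarrow> 'a::comm_semiring_1 mat \<Rightarrow> 'a tensor \<Rightarrow> 'a tensor"
  where "tensor_map d A T = (\<lambda>js. if js \<in> tensor_index (dim_row A) d
           then \<Sum>is\<in>tensor_index (dim_col A) d. (\<Prod>k<d. A $$ (js ! k, is ! k)) * T is else 0)"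

text \<open>The induced map on symmetric powers. All sets in the union coincide, by \<open>sym_map_class\<close> below.\<close>

definition sym_map :: "nat \<Rightarrow> 'a::field mat \<Rightarrow> 'a tensor set \<Rightarrow> 'a tensor set"
  where "sym_map d A f = (\<Union>T\<in>f. sym_class (dim_row A) d (tensor_map d A T))"

definition unit_sym_tensor :: "nat \<Rightarrow> nat \<Rightarrow> 'a::field tensor set"
  where "unit_sym_tensor r d = sym_class r d (\<Sum>i<r. pure_tensor (replicate d (unit_vec r i)))"

definition sym_linear_functional :: "nat \<Rightarrow> nat \<Rightarrow> ('a::field tensor set \<Rightarrow> 'a) \<Rightarrow> bool"
  where "sym_linear_functional n d l \<longleftrightarrow>
           (\<forall>S\<in>tensors n d. \<forall>T\<in>tensors n d.
              l (sym_class n d (S + T)) = l (sym_class n d S) + l (sym_class n d T)) \<and>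
           (\<forall>c. \<forall>T\<in>tensors n d. l (sym_class n d (tensor_scale c T)) = c * l (sym_class n d T))"

text \<open>
  The polynomial functions on \<open>S\<^sup>d K\<^sup>n\<close>: the algebra generated by the linear functionals. Only the
  values on \<^const>\<open>sym_power\<close> are relevant.
\<close>

inductive_set sym_poly_fun :: "nat \<Rightarrow> nat \<Rightarrow> ('a::field tensor set \<Rightarrow> 'a) set"
  for n d :: nat where
  const: "(\<lambda>_. c) \<in> sym_poly_fun n d"
| linear: "sym_linear_functional n d l \<Longrightarrow> l \<in> sym_poly_fun n d"
| add: "P \<in> sym_poly_fun n d \<Longrightarrow> Q \<in> sym_poly_fun n d \<Longrightarrow> (\<lambda>f. P f + Q f) \<in> sym_poly_fun n d"
| mult: "P \<in> sym_poly_fun n d \<Longrightarrow> Q \<in> sym_poly_fun n d \<Longrightarrow> (\<lambda>f. P f * Q f) \<in> sym_poly_fun n d"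

definition zariski_closure :: "nat \<Rightarrow> nat \<Rightarrow> 'a::field tensor set set \<Rightarrow> 'a tensor set set"
  where "zariski_closure n d X =
           {f \<in> sym_power n d. \<forall>P\<in>sym_poly_fun n d. (\<forall>g\<in>X. P g = 0) \<longrightarrow> P f = 0}"

definition zariski_dense :: "nat \<Rightarrow> nat \<Rightarrow> 'a::field tensor set set \<Rightarrow> bool"
  where "zariski_dense n d X \<longleftrightarrow> X \<subseteq> sym_power n d \<and> zariski_closure n d X = sym_power n d"

text \<open>
  If \<open>d\<close> is zero or a power of the characteristic exponent, the set below can be infinite and the
  value is then unspecified.
\<close>

definition border_subrank :: "nat \<Rightarrow> nat \<Rightarrow> 'a::field tensor set \<Rightarrow> nat"
  where "border_subrank n d f =
           Max {r. unit_sym_tensor r d \<in> zariski_closure r d {sym_map d A f | A. A \<in> carrier_mat r n}}"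

text \<open>
  \<open>r\<close> is the generic symmetric border subrank of \<open>S\<^sup>d K\<^sup>n\<close>. This is a predicate rather than a definite
  description, so that statements about it do not depend on the uniqueness of \<open>r\<close>.
\<close>

definition generic_border_subrank :: "'a::field itself \<Rightarrow> nat \<Rightarrow> nat \<Rightarrow> nat \<Rightarrow> bool"
  where "generic_border_subrank _ n d r \<longleftrightarrow>
           zariski_dense n d {f \<in> sym_power n d :: 'a tensor set set. border_subrank n d f = r}"


text \<open>Agreement of the coordinate definitions with the intrinsic ones.\<close>

lemma finite_tensor_index: "finite (tensor_index n d)"
proof -
  have "tensor_index n d = {xs. set xs \<subseteq> {..<n} \<and> length xs = d}"
    by (auto simp: tensor_index_def)
  then show ?thesis by (simp add: finite_lists_length_eq)
qed

lemma equiv_sym_equiv: "equiv (tensors n d) (sym_equiv n d :: ('a::field tensor \<times> 'a tensor) set)"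
proof (rule equivI)
  show "(sym_equiv n d :: ('a tensor \<times> 'a tensor) set) \<subseteq> tensors n d \<times> tensors n d"
    by (auto simp: sym_equiv_def)
  show "refl_on (tensors n d) (sym_equiv n d :: ('a tensor \<times> 'a tensor) set)"
    by (auto simp: refl_on_def sym_equiv_def sym_relations_def tensor.span_zero)
  show "sym (sym_equiv n d :: ('a tensor \<times> 'a tensor) set)"
    unfolding sym_def sym_equiv_def sym_relations_def
    using tensor.span_neg by fastforce
  show "trans (sym_equiv n d :: ('a tensor \<times> 'a tensor) set)"
    unfolding trans_def sym_equiv_def sym_relations_def
    by clarsimp (metis (no_types, lifting) diff_add_cancel add_diff_eq tensor.span_add)
qed

lemma tensor_index_permute:
  assumes "\<sigma> permutes {..<d}"
  shows "bij_betw (permute_list \<sigma>) (tensor_index n d) (tensor_index n d)"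
proof (rule bij_betw_byWitness[where f' = "permute_list (inv_into UNIV \<sigma>)"])
  have inv: "inv_into UNIV \<sigma> permutes {..<d}" using assms by (rule permutes_inv)
  have comp: "permute_list \<tau> (permute_list \<rho> is) = is"
    if "\<tau> permutes {..<d}" "\<rho> permutes {..<d}" "\<rho> \<circ> \<tau> = id" "length is = d" for \<tau> \<rho> and "is" :: "nat list"
    using permute_list_compose[of \<tau> "is" \<rho>] that by simp
  show "\<forall>a\<in>tensor_index n d. permute_list (inv_into UNIV \<sigma>) (permute_list \<sigma> a) = a"
    using comp[OF inv assms] assms by (auto simp: tensor_index_def permutes_inv_o)
  show "\<forall>a\<in>tensor_index n d. permute_list \<sigma> (permute_list (inv_into UNIV \<sigma>) a) = a"
    using comp[OF assms inv] assms by (auto simp: tensor_index_def permutes_inv_o)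
  show "permute_list \<sigma> ` tensor_index n d \<subseteq> tensor_index n d"
    using assms by (auto simp: tensor_index_def)
  show "permute_list (inv_into UNIV \<sigma>) ` tensor_index n d \<subseteq> tensor_index n d"
    using inv by (auto simp: tensor_index_def)
qed

lemma pure_tensor_in_tensors:
  assumes "length vs = d" "\<forall>v\<in>set vs. dim_vec v = n"
  shows "pure_tensor vs \<in> tensors n d"
proof -
  have "is \<in> tensor_index n d" if "list_all2 (\<lambda>i v. i < dim_vec v) is vs" for "is"
    using that assms by (auto simp: tensor_index_def list_all2_conv_all_nth set_conv_nth)
  then show ?thesis by (auto simp: tensors_def pure_tensor_def)
qed

lemma permute_pure_tensor:
  assumes \<sigma>: "\<sigma> permutes {..<length vs}"
  shows "permute_tensor \<sigma> (pure_tensor vs) = pure_tensor (permute_list (inv_into UNIV \<sigma>) vs)"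
proof
  fix "is" :: "nat list"
  have inv: "inv_into UNIV \<sigma> permutes {..<length vs}" using \<sigma> by (rule permutes_inv)
  have 1: "permute_list (inv_into UNIV \<sigma>) vs ! k = vs ! inv_into UNIV \<sigma> k" if "k < length vs" for k
    using that inv by (simp add: permute_list_nth)
  have s1: "\<sigma> k < length vs \<longleftrightarrow> k < length vs" "inv_into UNIV \<sigma> k < length vs \<longleftrightarrow> k < length vs" for k
    using permutes_in_image[OF \<sigma>, of k] permutes_in_image[OF inv, of k] by auto
  have s2: "\<sigma> (inv_into UNIV \<sigma> k) = k" "inv_into UNIV \<sigma> (\<sigma> k) = k" for k
    using \<sigma> by (auto simp: permutes_inverses)
  show "permute_tensor \<sigma> (pure_tensor vs) is = pure_tensor (permute_list (inv_into UNIV \<sigma>) vs) is"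
  proof (cases "length is = length vs")
    case False
    then show ?thesis
      by (auto simp: permute_tensor_def pure_tensor_def dest: list_all2_lengthD)
  next
    case True
    then have 2: "permute_list \<sigma> is ! k = is ! \<sigma> k" if "k < length vs" for k
      using that \<sigma> by (simp add: permute_list_nth)
    have A: "(\<forall>k<length vs. is ! \<sigma> k < dim_vec (vs ! k)) \<longleftrightarrow>
          (\<forall>k<length vs. is ! k < dim_vec (vs ! inv_into UNIV \<sigma> k))"
      by (metis s1 s2)
    have "(\<Prod>k<length vs. (vs ! k) $ (is ! \<sigma> k)) = (\<Prod>k<length vs. (vs ! inv_into UNIV \<sigma> k) $ (is ! k))"
      by (rule prod.reindex_bij_witness[where i = "inv_into UNIV \<sigma>" and j = \<sigma>]) (auto simp: s1 s2)
    then show ?thesis using True A 1 2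
      by (auto simp: permute_tensor_def pure_tensor_def list_all2_conv_all_nth)
  qed
qed

lemma tensor_map_pure_tensor:
  fixes A :: "'a::comm_ring_1 mat"
  assumes A: "A \<in> carrier_mat r n" and len: "length vs = d" and vs: "\<forall>v\<in>set vs. dim_vec v = n"
  shows "tensor_map d A (pure_tensor vs) = pure_tensor (map (\<lambda>v. A *\<^sub>v v) vs)"
proof
  fix js :: "nat list"
  have dims: "dim_row A = r" "dim_col A = n" using A by auto
  have vsk: "dim_vec (vs ! k) = n" if "k < d" for k using vs len that by auto
  have idx: "js \<in> tensor_index r d \<longleftrightarrow> list_all2 (\<lambda>i v. i < dim_vec v) js (map (\<lambda>v. A *\<^sub>v v) vs)"
    using dims len by (auto simp: tensor_index_def list_all2_conv_all_nth set_conv_nth)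
  show "tensor_map d A (pure_tensor vs) js = pure_tensor (map (\<lambda>v. A *\<^sub>v v) vs) js"
  proof (cases "js \<in> tensor_index r d")
    case False
    then show ?thesis using idx dims by (simp add: tensor_map_def pure_tensor_def)
  next
    case True
    then have js: "length js = d" "\<And>k. k < d \<Longrightarrow> js ! k < r"
      by (auto simp: tensor_index_def subset_eq)
    have bij: "bij_betw (\<lambda>g. map g [0..<d]) (PiE {..<d} (\<lambda>_. {..<n})) (tensor_index n d)"
    proof (rule bij_betw_byWitness[where f' = "\<lambda>is. restrict (\<lambda>k. is ! k) {..<d}"])
      show "\<forall>g\<in>PiE {..<d} (\<lambda>_. {..<n}). restrict (\<lambda>k. map g [0..<d] ! k) {..<d} = g"
        by (auto simp: fun_eq_iff PiE_def extensional_def restrict_def)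
      show "\<forall>is\<in>tensor_index n d. map (restrict ((!) is) {..<d}) [0..<d] = is"
        by (auto simp: tensor_index_def intro: nth_equalityI)
      show "(\<lambda>g. map g [0..<d]) ` PiE {..<d} (\<lambda>_. {..<n}) \<subseteq> tensor_index n d"
        by (auto simp: tensor_index_def PiE_def Pi_def)
      show "(\<lambda>is. restrict ((!) is) {..<d}) ` tensor_index n d \<subseteq> PiE {..<d} (\<lambda>_. {..<n})"
        by (auto simp: tensor_index_def PiE_def Pi_def set_conv_nth)
    qed
    have "tensor_map d A (pure_tensor vs) js =
        (\<Sum>is\<in>tensor_index n d. (\<Prod>k<d. A $$ (js ! k, is ! k)) * pure_tensor vs is)"
      using True dims by (simp add: tensor_map_def)
    also have "\<dots> = (\<Sum>is\<in>tensor_index n d. \<Prod>k<d. A $$ (js ! k, is ! k) * (vs ! k) $ (is ! k))"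
    proof (rule sum.cong[OF refl])
      fix "is" assume "is \<in> tensor_index n d"
      then have "list_all2 (\<lambda>i v. i < dim_vec v) is vs"
        using len vsk by (auto simp: tensor_index_def list_all2_conv_all_nth subset_eq)
      then show "(\<Prod>k<d. A $$ (js ! k, is ! k)) * pure_tensor vs is =
          (\<Prod>k<d. A $$ (js ! k, is ! k) * (vs ! k) $ (is ! k))"
        using len by (simp add: pure_tensor_def prod.distrib)
    qed
    also have "\<dots> = (\<Sum>g\<in>PiE {..<d} (\<lambda>_. {..<n}). \<Prod>k<d. A $$ (js ! k, g k) * (vs ! k) $ (g k))"
      by (subst sum.reindex_bij_betw[OF bij, symmetric]) simp
    also have "\<dots> = (\<Prod>k<d. \<Sum>i<n. A $$ (js ! k, i) * (vs ! k) $ i)"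
      by (subst prod_sum_PiE) auto
    also have "\<dots> = (\<Prod>k<d. (A *\<^sub>v (vs ! k)) $ (js ! k))"
      using js dims vsk
      by (intro prod.cong refl) (auto simp: scalar_prod_def lessThan_atLeast0 intro!: sum.cong)
    also have "\<dots> = pure_tensor (map (\<lambda>v. A *\<^sub>v v) vs) js"
      using True idx len by (simp add: pure_tensor_def)
    finally show ?thesis .
  qed
qed

lemma tensor_map_in_tensors: "tensor_map d A T \<in> tensors (dim_row A) d"
  by (simp add: tensor_map_def tensors_def)

lemma tensor_map_add: "tensor_map d A (S + T) = tensor_map d A S + tensor_map d A T"
  by (auto simp: tensor_map_def fun_eq_iff distrib_left sum.distrib)

lemma tensor_map_scale: "tensor_map d A (tensor_scale c T) = tensor_scale c (tensor_map d A T)"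
  by (auto simp: tensor_map_def tensor_scale_def fun_eq_iff sum_distrib_left mult_ac)

lemma tensor_map_diff:
  fixes S T :: "'a::comm_ring_1 tensor"
  shows "tensor_map d A (S - T) = tensor_map d A S - tensor_map d A T"
  by (auto simp: tensor_map_def fun_eq_iff right_diff_distrib sum_subtractf)

lemma tensor_map_permute:
  fixes A :: "'a::comm_ring_1 mat"
  assumes \<sigma>: "\<sigma> permutes {..<d}"
  shows "tensor_map d A (permute_tensor \<sigma> T) = permute_tensor \<sigma> (tensor_map d A T)"
proof
  fix js :: "nat list"
  have mem: "permute_list \<sigma> js \<in> tensor_index m d \<longleftrightarrow> js \<in> tensor_index m d" for m
    using \<sigma> by (auto simp: tensor_index_def)
  show "tensor_map d A (permute_tensor \<sigma> T) js = permute_tensor \<sigma> (tensor_map d A T) js"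
  proof (cases "js \<in> tensor_index (dim_row A) d")
    case False
    then show ?thesis using mem by (simp add: tensor_map_def permute_tensor_def)
  next
    case True
    have jl: "length js = d" using True by (simp add: tensor_index_def)
    have "(\<Sum>is\<in>tensor_index (dim_col A) d. (\<Prod>k<d. A $$ (permute_list \<sigma> js ! k, is ! k)) * T is) =
       (\<Sum>is\<in>tensor_index (dim_col A) d.
          (\<Prod>k<d. A $$ (permute_list \<sigma> js ! k, permute_list \<sigma> is ! k)) * T (permute_list \<sigma> is))"
      by (subst sum.reindex_bij_betw[OF tensor_index_permute[OF \<sigma>], symmetric]) simp
    also have "\<dots> = (\<Sum>is\<in>tensor_index (dim_col A) d.
        (\<Prod>k<d. A $$ (js ! k, is ! k)) * T (permute_list \<sigma> is))"
    proof (rule sum.cong[OF refl])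
      fix "is" assume "is \<in> tensor_index (dim_col A) d"
      then have il: "length is = d" by (simp add: tensor_index_def)
      have "(\<Prod>k<d. A $$ (permute_list \<sigma> js ! k, permute_list \<sigma> is ! k)) =
          (\<Prod>k<d. A $$ (js ! \<sigma> k, is ! \<sigma> k))"
        using \<sigma> il jl by (intro prod.cong) (auto simp: permute_list_nth)
      also have "\<dots> = (\<Prod>k<d. A $$ (js ! k, is ! k))"
        by (rule prod.reindex_bij_betw) (use \<sigma> in \<open>rule permutes_imp_bij\<close>)
      finally show "(\<Prod>k<d. A $$ (permute_list \<sigma> js ! k, permute_list \<sigma> is ! k)) * T (permute_list \<sigma> is) =
          (\<Prod>k<d. A $$ (js ! k, is ! k)) * T (permute_list \<sigma> is)" by simp
    qed
    finally show ?thesis using True mem by (simp add: tensor_map_def permute_tensor_def)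
  qed
qed

lemma tensor_map_sym_relations:
  fixes A :: "'a::field mat"
  assumes "T \<in> sym_relations (dim_col A) d"
  shows "tensor_map d A T \<in> sym_relations (dim_row A) d"
  using assms unfolding sym_relations_def
proof (induction rule: tensor.span_induct_alt)
  case base
  have "tensor_map d A 0 = 0" by (simp add: tensor_map_def fun_eq_iff)
  then show ?case by (simp only: tensor.span_zero)
next
  case (step c x y)
  then obtain T \<sigma> where x: "x = T - permute_tensor \<sigma> T" and \<sigma>: "\<sigma> permutes {..<d}" by auto
  have "tensor_map d A x = tensor_map d A T - permute_tensor \<sigma> (tensor_map d A T)"
    by (simp add: x tensor_map_diff tensor_map_permute[OF \<sigma>])
  then have "tensor_map d A x \<in> tensor.span {T - permute_tensor \<sigma> T | T \<sigma>. T \<in> tensors (dim_row A) d \<and> \<sigma> permutes {..<d}}"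
    using \<sigma> tensor_map_in_tensors by (intro tensor.span_base) blast
  then show ?case using step.IH
    unfolding tensor_map_add tensor_map_scale by (intro tensor.span_add tensor.span_scale)
qed

lemma sym_map_class:
  fixes A :: "'a::field mat"
  assumes "A \<in> carrier_mat r n" "T \<in> tensors n d"
  shows "sym_map d A (sym_class n d T) = sym_class r d (tensor_map d A T)"
proof -
  have dims: "dim_row A = r" "dim_col A = n" using assms by auto
  have T: "T \<in> sym_class n d T"
    using equiv_class_self[OF equiv_sym_equiv assms(2)] by (simp add: sym_class_def)
  have "sym_class r d (tensor_map d A S) = sym_class r d (tensor_map d A T)"
    if "S \<in> sym_class n d T" for S
  proof -
    have "T - S \<in> sym_relations n d" using that by (simp add: sym_class_def sym_equiv_def)
    then have "tensor_map d A T - tensor_map d A S \<in> sym_relations r d"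
      using tensor_map_sym_relations[of "T - S" A d] dims by (simp add: tensor_map_diff)
    then have "(tensor_map d A T, tensor_map d A S) \<in> sym_equiv r d"
      using tensor_map_in_tensors[of d A] dims by (auto simp: sym_equiv_def)
    from equiv_class_eq[OF equiv_sym_equiv this] show ?thesis by (simp add: sym_class_def)
  qed
  then show ?thesis using T dims unfolding sym_map_def by blast
qed

end

theory Submission
  imports Defs "HOL-Combinatorics.Multiset_Permutations"
begin

text \<open>
  View a tensor \<open>T\<close> on \<open>K\<^sup>n\<close> as the form \<open>F\<close> of degree \<open>d\<close> on the dual space. The map with matrix \<open>A\<close>
  turns \<open>F\<close> into \<open>F \<circ> A\<^sup>T\<close>, and the unit tensor \<open>I\<^sub>r\<close> is the power sum \<open>y\<^sub>1\<^sup>d + \<dots> + y\<^sub>r\<^sup>d\<close>. The proof has an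
  infinitesimal part, which replaces a degeneration to \<open>I\<^sub>r\<close> by an honest restriction to about half as
  many variables, and a dimension count for the forms that have such a restriction.

  \<^bold>\<open>From degeneration to restriction.\<close> That \<open>I\<^sub>r\<close> lies in the closure of the tensors \<open>A f\<close> says
  exactly that \<open>P (A f) \<mapsto> P I\<^sub>r\<close> is a well defined homomorphism to \<open>K\<close>, from an algebra of functions
  of the matrix \<open>A\<close>. Because \<open>K\<close> is algebraically closed, it extends to a place, that is, to a
  homomorphism on so many functions of \<open>A\<close> that each remaining one has infinitesimal inverse
  (\<open>hom_graph_extends_to_place\<close>). With respect to this place the generic matrix \<open>A\<^sup>T\<close> can be brought
  into a normal form by Gaussian elimination (\<open>elimination\<close>). The coordinate directions of \<open>K\<^sup>r\<close> split
  into two groups: for those in a set \<open>J\<close> there are finite vectors whose images under \<open>A\<^sup>T\<close> have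
  linearly independent limits in \<open>K\<^sup>n\<close>, and for the others there are finite vectors with
  infinitesimal image. On the limits of the latter the power sum vanishes, since \<open>F \<circ> A\<^sup>T\<close> does so in
  the limit. As \<open>d\<close> is not a power of the characteristic exponent, some binomial coefficient
  \<open>d choose a\<close> with \<open>0 < a < d\<close> is nonzero in \<open>K\<close>; hence the power sum has a nondegenerate
  polarisation, and a subspace on which it vanishes has at most half the dimension
  (\<open>isotropic_subspace_card\<close>). So \<open>J\<close> has at least \<open>r / 2\<close> elements, and the limits that belong to \<open>J\<close>
  span a space on which \<open>F\<close> is a sum of \<open>d\<close>-th powers of linear forms. Applied to the first \<open>2 * m\<close>
  coordinates, this gives \<open>m\<close> independent vectors of \<open>K\<^sup>n\<close> on whose span \<open>F\<close> is a sum of \<open>2 * m\<close>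
  powers (\<open>restricted_power_sum_if_degeneration\<close>).

  \<^bold>\<open>Counting.\<close> Up to the choice of pivot coordinates, the vectors and the linear forms have at most
  \<open>m * n + m * (2 * m)\<close> coordinates, and they determine \<open>(m + d - 1) choose d \<ge> m\<^sup>d / d!\<close> coefficients
  of \<open>F\<close> in terms of the other ones. If \<open>m\<^sup>d\<^sup>-\<^sup>1\<close> exceeds a suitable multiple of \<open>n + m\<close>, the forms with
  such a restriction depend on fewer parameters than there are coefficients, so that a nonzero
  polynomial vanishes on all of them (\<open>restricted_power_sums_hypersurface\<close>). Outside this hypersurface
  the border subrank is less than \<open>2 * m\<close>, which is \<open>O(n\<^sup>1\<^sup>/\<^sup>(\<^sup>d\<^sup>-\<^sup>1\<^sup>))\<close> for a suitable \<open>m\<close>. A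
  generic value exists because only finitely many values occur there and the polynomial functions on
  the symmetric power have no zero divisors (\<open>sym_power_irreducible\<close>).
\<close>

section \<open>Independence of characters and linear systems\<close>

lemma infinite_alg_closed_field: "infinite (UNIV :: 'k::alg_closed_field set)"
proof
  assume fin: "finite (UNIV :: 'k set)"
  define p :: "'k poly" where "p = (\<Prod>a\<in>UNIV. [:- a, 1:]) + 1"
  have "degree (\<Prod>a\<in>UNIV. [:- a, 1:] :: 'k poly) = card (UNIV :: 'k set)"
    by (subst degree_prod_sum_eq) auto
  moreover have "card (UNIV :: 'k set) > 0"
    using fin by (simp add: card_gt_0_iff)
  ultimately have "degree p > 0"
    unfolding p_def by (subst degree_add_eq_left) auto
  then obtain x where "poly p x = 0"
    using alg_closed_imp_poly_has_root by blast
  moreover have "poly (\<Prod>a\<in>UNIV. [:- a, 1:]) x = 0"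
    using fin by (auto simp: poly_prod)
  ultimately show False
    by (simp add: p_def)
qed

lemma poly_eq_0_if_vanishes:
  fixes p :: "'k::alg_closed_field poly"
  assumes "\<And>x. poly p x = 0"
  shows "p = 0"
  using assms poly_roots_finite[of p] infinite_alg_closed_field[where 'k='k] by auto

lemma ex_power_neq:
  assumes "a \<noteq> (b::nat)"
  shows "\<exists>t::'k::alg_closed_field. t ^ a \<noteq> t ^ b"
proof (rule ccontr)
  assume "\<not> ?thesis"
  then have "poly (monom 1 a - monom 1 b :: 'k poly) x = 0" for x
    by (simp add: poly_monom)
  then have "monom (1::'k) a = monom 1 b"
    using poly_eq_0_if_vanishes by (metis eq_iff_diff_eq_0)
  then show False
    using assms by (metis degree_monom_eq one_neq_zero)
qed

text \<open>
  Artin's argument: in a relation, replace \<open>x\<close> by \<open>y * x\<close> and subtract \<open>\<chi> e0 y\<close> times the original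
  relation. The term of \<open>e0\<close> disappears, and every other coefficient is multiplied by
  \<open>\<chi> e y - \<chi> e0 y\<close>, which is nonzero for some \<open>y\<close>.
\<close>

lemma characters_independent:
  fixes \<chi> :: "'e \<Rightarrow> 'm::monoid_mult \<Rightarrow> 'k::field"
  assumes "finite E"
    and mult: "\<And>e x y. e \<in> E \<Longrightarrow> \<chi> e (x * y) = \<chi> e x * \<chi> e y"
    and one: "\<And>e. e \<in> E \<Longrightarrow> \<chi> e 1 = 1"
    and distinct: "\<And>e e'. e \<in> E \<Longrightarrow> e' \<in> E \<Longrightarrow> e \<noteq> e' \<Longrightarrow> \<exists>x. \<chi> e x \<noteq> \<chi> e' x"
    and zero: "\<And>x. (\<Sum>e\<in>E. a e * \<chi> e x) = 0"
    and "e \<in> E"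
  shows "a e = 0"
  using assms
proof (induction E arbitrary: a e rule: finite_induct)
  case (insert e0 E)
  have rest: "a e = 0" if e: "e \<in> E" for e
  proof -
    obtain y where y: "\<chi> e y \<noteq> \<chi> e0 y"
      using insert.prems(3)[of e e0] e insert.hyps by auto
    have "(\<Sum>e\<in>E. a e * (\<chi> e y - \<chi> e0 y) * \<chi> e x) = 0" for x
    proof -
      have "(\<Sum>e\<in>E. a e * (\<chi> e y - \<chi> e0 y) * \<chi> e x)
          = (\<Sum>e\<in>insert e0 E. a e * (\<chi> e y - \<chi> e0 y) * \<chi> e x)"
        using insert.hyps by simp
      also have "\<dots> = (\<Sum>e\<in>insert e0 E. a e * \<chi> e (y * x) - \<chi> e0 y * (a e * \<chi> e x))"
        by (rule sum.cong) (auto simp: insert.prems(1) algebra_simps)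
      also have "\<dots> = 0"
        unfolding sum_subtractf sum_distrib_left[symmetric] insert.prems(4) by simp
      finally show ?thesis .
    qed
    then have "a e * (\<chi> e y - \<chi> e0 y) = 0"
      using insert.IH[where a = "\<lambda>e. a e * (\<chi> e y - \<chi> e0 y)" and e = e] insert.prems(1-3) e
      by blast
    with y show ?thesis by simp
  qed
  moreover have "a e0 = 0"
    using insert.prems(4)[of 1] insert.prems(2)[of e0] rest insert.hyps by simp
  ultimately show ?case
    using insert.prems(5) by auto
qed simp

text \<open>
  Monomials are characters of the multiplicative monoid \<open>K\<^sup>I\<close>, and over an infinite field different
  exponents give different characters.
\<close>

lemma exponent_monomials_independent:
  fixes a :: "('i \<Rightarrow> nat) \<Rightarrow> 'k::alg_closed_field"
  assumes I: "finite I" and D: "\<And>i. i \<in> I \<Longrightarrow> finite (D i)"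
    and zero: "\<And>x. (\<Sum>g\<in>PiE I D. a g * (\<Prod>i\<in>I. x i ^ g i)) = 0" and g: "g \<in> PiE I D"
  shows "a g = 0"
proof (rule characters_independent[where E = "PiE I D" and \<chi> = "\<lambda>g x. \<Prod>i\<in>I. x i ^ g i"])
  show "finite (PiE I D)" using I D by (rule finite_PiE)
  show "\<exists>x. (\<Prod>i\<in>I. x i ^ g i) \<noteq> (\<Prod>i\<in>I. x i ^ g' i :: 'k)"
    if g: "g \<in> PiE I D" "g' \<in> PiE I D" "g \<noteq> g'" for g g'
  proof -
    obtain i where i: "i \<in> I" "g i \<noteq> g' i"
      using g by (metis PiE_ext)
    then obtain t :: 'k where t: "t ^ g i \<noteq> t ^ g' i"
      using ex_power_neq by blast
    have "(\<Prod>j\<in>I. (if j = i then t else 1) ^ h j) = t ^ h i" for h :: "'i \<Rightarrow> nat"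
      using I i prod.delta[OF I, of i "\<lambda>j. t ^ h j"] by (simp add: if_distrib[of "\<lambda>x. x ^ _"] cong: if_cong)
    then show ?thesis using t by (intro exI[of _ "\<lambda>j. if j = i then t else 1"]) simp
  qed
qed (use zero g in \<open>auto simp: power_mult_distrib prod.distrib\<close>)

lemma multiset_monomials_independent:
  fixes a :: "'i multiset \<Rightarrow> 'k::alg_closed_field"
  assumes E: "finite E"
    and zero: "\<And>x. (\<Sum>M\<in>E. a M * (\<Prod>i\<in>#M. x i)) = 0" and M: "M \<in> E"
  shows "a M = 0"
proof (rule characters_independent[where E = E and \<chi> = "\<lambda>M x. \<Prod>i\<in>#M. x i"])
  show "\<exists>x. (\<Prod>i\<in>#M. x i) \<noteq> (\<Prod>i\<in>#M'. x i :: 'k)"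
    if "M \<noteq> M'" for M M' :: "'i multiset"
  proof -
    obtain i where "count M i \<noteq> count M' i"
      using \<open>M \<noteq> M'\<close> by (auto simp: multiset_eq_iff)
    then obtain t :: 'k where t: "t ^ count M i \<noteq> t ^ count M' i"
      using ex_power_neq by blast
    have "(\<Prod>j\<in>#N. if j = i then t else 1) = t ^ count N i" for N :: "'i multiset"
      by (induction N) auto
    then show ?thesis using t by (intro exI[of _ "\<lambda>j. if j = i then t else 1"]) simp
  qed
qed (use E zero M in \<open>auto simp: prod_mset.distrib\<close>)

text \<open>
  One equation either is trivial or can be solved for an unknown \<open>u\<close> and used to remove both from the
  system.
\<close>

lemma underdetermined_system:
  fixes a :: "'e \<Rightarrow> 'v \<Rightarrow> 'k::field"
  assumes "finite Eq" "finite V" "card Eq < card V"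
  shows "\<exists>x. (\<exists>v\<in>V. x v \<noteq> 0) \<and> (\<forall>e\<in>Eq. (\<Sum>v\<in>V. a e v * x v) = 0)"
  using assms
proof (induction Eq arbitrary: V a rule: finite_induct)
  case empty
  then have "V \<noteq> {}" by auto
  then show ?case by (intro exI[of _ "\<lambda>_. 1"]) auto
next
  case (insert e0 Eq)
  show ?case
  proof (cases "\<forall>v\<in>V. a e0 v = 0")
    case True
    moreover have "card Eq < card V" using insert by simp
    ultimately show ?thesis using insert.IH[of V a] insert.prems by auto
  next
    case False
    then obtain u where u: "u \<in> V" "a e0 u \<noteq> 0" by auto
    define W where "W = V - {u}"
    have W: "finite W" "card Eq < card W" "u \<notin> W" "V = insert u W"
      using insert u by (auto simp: W_def)
    from insert.IH[OF W(1,2), of "\<lambda>e v. a e v - a e u * a e0 v / a e0 u"]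
    obtain x where x: "\<exists>v\<in>W. x v \<noteq> 0"
      "\<And>e. e \<in> Eq \<Longrightarrow> (\<Sum>v\<in>W. (a e v - a e u * a e0 v / a e0 u) * x v) = 0" by blast
    define s where "s = - (\<Sum>v\<in>W. a e0 v * x v) / a e0 u"
    have sum: "(\<Sum>v\<in>V. a e v * (x(u := s)) v) = (\<Sum>v\<in>W. a e v * x v) + a e u * s" for e
    proof -
      have "(\<Sum>v\<in>W. a e v * (x(u := s)) v) = (\<Sum>v\<in>W. a e v * x v)"
        using W(3) by (intro sum.cong) auto
      then show ?thesis using W by (simp add: add.commute)
    qed
    show ?thesis
    proof (intro exI[of _ "x(u := s)"] conjI ballI)
      show "\<exists>v\<in>V. (x(u := s)) v \<noteq> 0" using x(1) W by auto
      fix e assume "e \<in> insert e0 Eq"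
      then consider "e = e0" | "e \<in> Eq" by auto
      then show "(\<Sum>v\<in>V. a e v * (x(u := s)) v) = 0"
      proof cases
        case 1 then show ?thesis unfolding sum using u by (simp add: s_def)
      next
        case 2
        have "0 = (\<Sum>v\<in>W. a e v * x v) - a e u / a e0 u * (\<Sum>v\<in>W. a e0 v * x v)"
          unfolding x(2)[OF 2, symmetric] sum_distrib_left sum_subtractf[symmetric]
          by (intro sum.cong) (auto simp: algebra_simps)
        then show ?thesis unfolding sum by (simp add: s_def)
      qed
    qed
  qed
qed

text \<open>
  In characteristic \<open>p\<close> write \<open>d = p\<^sup>k * m\<close> with \<open>p\<close> not dividing \<open>m\<close>. Then
  \<open>(1 + X)\<^sup>d = (1 + X ^ p\<^sup>k)\<^sup>m\<close>, and the coefficient of \<open>X ^ p\<^sup>k\<close> is \<open>m \<noteq> 0\<close>. This is an inner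
  coefficient since \<open>m \<noteq> 1\<close>.
\<close>

lemma ex_binomial_neq_0:
  fixes d :: nat
  assumes d0: "d > 0" and d: "\<And>k. d \<noteq> char_exponent TYPE('k::alg_closed_field) ^ k"
  shows "\<exists>a. 0 < a \<and> a < d \<and> of_nat (d choose a) \<noteq> (0::'k)"
proof (cases "CHAR('k) = 0")
  case True
  then have "d \<noteq> 1" using d[of 0] by simp
  moreover have "of_nat d \<noteq> (0::'k)"
    using True d0 by (simp add: of_nat_eq_0_iff_char_dvd)
  ultimately show ?thesis using d0 by (intro exI[of _ 1]) auto
next
  case False
  define p where "p = CHAR('k)"
  have p: "prime p" using False prime_CHAR_semidom[where 'a='k] by (simp add: p_def)
  obtain k m where dm: "d = p ^ k * m" "\<not> p dvd m"
    using p d0 by (metis multiplicity_decompose' not_prime_unit gr_implies_not0)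
  have "m \<noteq> 1" using d[of k] dm False by (auto simp: char_exponent_def p_def)
  moreover have "m \<noteq> 0" using dm d0 by auto
  ultimately have m: "m > 1" by simp
  have less: "p ^ k < d" using m p dm by (simp add: prime_gt_0_nat)

  have X: "(1 + monom 1 1 :: 'k poly) ^ p ^ k = 1 + monom 1 (p ^ k)"
    using freshmans_dream'[where 'a = "'k poly" and m = "p ^ k" and n = k and x = 1 and y = "monom 1 1"] p
    by (simp add: p_def monom_power)
  have eq: "(\<Sum>i\<le>d. monom (of_nat (d choose i)) i) = (\<Sum>j\<le>m. monom (of_nat (m choose j)) (p ^ k * j) :: 'k poly)"
  proof -
    have "(\<Sum>i\<le>d. monom (of_nat (d choose i)) i :: 'k poly) = (1 + monom 1 1) ^ d"
      unfolding binomial_ring[of "monom 1 1 :: 'k poly" 1 d, folded add.commute[of 1]]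
      by (simp add: monom_power of_nat_poly mult_monom add.commute smult_monom)
    also have "\<dots> = (1 + monom 1 (p ^ k)) ^ m"
      by (simp only: dm(1) power_mult X)
    also have "\<dots> = (\<Sum>j\<le>m. monom (of_nat (m choose j)) (p ^ k * j))"
      unfolding add.commute[of 1] binomial_ring
      by (simp add: monom_power of_nat_poly smult_monom)
    finally show ?thesis .
  qed
  have "of_nat (d choose p ^ k) = coeff (\<Sum>i\<le>d. monom (of_nat (d choose i)) i :: 'k poly) (p ^ k)"
    using less by (simp add: coeff_sum)
  also have "\<dots> = (\<Sum>j\<le>m. if j = 1 then of_nat (m choose j) else 0)"
    unfolding eq using p by (auto simp: coeff_sum prime_gt_0_nat intro!: sum.cong)
  also have "\<dots> = of_nat m" using m by simp
  also have "\<dots> \<noteq> 0" using dm(2) by (simp add: of_nat_eq_0_iff_char_dvd p_def)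
  finally show ?thesis using less p by (intro exI[of _ "p ^ k"]) (auto simp: prime_gt_0_nat)
qed

section \<open>Places on algebras of functions\<close>

lemma sum_fun_apply: "(\<Sum>i\<in>I. f i) x = (\<Sum>i\<in>I. f i x)"
  by (induction I rule: infinite_finite_induct) auto

lemma prod_fun_apply: "(\<Prod>i\<in>I. f i) x = (\<Prod>i\<in>I. f i x)"
  by (induction I rule: infinite_finite_induct) auto

lemma prod_mset_fun_apply: "(\<Prod>i\<in>#M. f i) x = (\<Prod>i\<in>#M. f i x)"
  by (induction M) auto

lemma power_fun_apply: "(f ^ n) x = f x ^ n"
  for f :: "'x \<Rightarrow> 'k::comm_semiring_1"
  by (induction n) auto

text \<open>
  The graph of a homomorphism to \<open>K\<close>, defined on a \<open>K\<close>-algebra of \<open>K\<close>-valued functions. With graphs,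
  extension of homomorphisms is inclusion of sets. Since a graph is closed under subtraction, it is
  single-valued as soon as \<open>0\<close> has no other value than \<open>0\<close>. In the application the functions depend on
  a matrix, and the value of the homomorphism plays the role of a limit.
\<close>

locale hom_graph =
  fixes G :: "(('x \<Rightarrow> 'k::field) \<times> 'k) set"
  assumes const: "(\<lambda>_. c, c) \<in> G"
    and add: "(u, a) \<in> G \<Longrightarrow> (v, b) \<in> G \<Longrightarrow> (u + v, a + b) \<in> G"
    and mult: "(u, a) \<in> G \<Longrightarrow> (v, b) \<in> G \<Longrightarrow> (u * v, a * b) \<in> G"
    and zero: "(0, a) \<in> G \<Longrightarrow> a = 0"
begin

lemma zero_in: "(0, 0) \<in> G"
  using const[of 0] by (simp add: zero_fun_def)

lemma one_in: "(1, 1) \<in> G"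
  using const[of 1] by (simp add: one_fun_def)

lemma uminus: "(u, a) \<in> G \<Longrightarrow> (- u, - a) \<in> G"
  using mult[OF const[of "- 1"], of u a] by (simp add: times_fun_def fun_Compl_def)

lemma diff: "(u, a) \<in> G \<Longrightarrow> (v, b) \<in> G \<Longrightarrow> (u - v, a - b) \<in> G"
  using add[OF _ uminus] by fastforce

lemma unique: "(u, a) \<in> G \<Longrightarrow> (u, b) \<in> G \<Longrightarrow> a = b"
  using diff[of u a u b] zero[of "a - b"] by simp

lemma sum: "(\<And>i. i \<in> I \<Longrightarrow> (u i, a i) \<in> G) \<Longrightarrow> ((\<Sum>i\<in>I. u i), (\<Sum>i\<in>I. a i)) \<in> G"
  by (induction I rule: infinite_finite_induct) (auto intro: add zero_in)

lemma prod: "(\<And>i. i \<in> I \<Longrightarrow> (u i, a i) \<in> G) \<Longrightarrow> ((\<Prod>i\<in>I. u i), (\<Prod>i\<in>I. a i)) \<in> G"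
  by (induction I rule: infinite_finite_induct) (auto intro: mult one_in)

lemma prod_mset: "(\<And>i. i \<in># M \<Longrightarrow> (u i, a i) \<in> G) \<Longrightarrow> ((\<Prod>i\<in>#M. u i), (\<Prod>i\<in>#M. a i)) \<in> G"
  by (induction M) (auto intro: mult one_in)

lemma power: "(u, a) \<in> G \<Longrightarrow> (u ^ n, a ^ n) \<in> G"
  by (induction n) (auto intro: mult one_in)

text \<open>
  The homomorphism maps the coefficients of \<open>q\<close> to those of \<open>p\<close>.
\<close>

definition lifts :: "('x \<Rightarrow> 'k) poly \<Rightarrow> 'k poly \<Rightarrow> bool"
  where "lifts q p \<longleftrightarrow> (\<forall>i. (coeff q i, coeff p i) \<in> G)"

lemma lifts_add: "lifts q p \<Longrightarrow> lifts q' p' \<Longrightarrow> lifts (q + q') (p + p')"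
  by (auto simp: lifts_def intro: add)

lemma lifts_mult: "lifts q p \<Longrightarrow> lifts q' p' \<Longrightarrow> lifts (q * q') (p * p')"
  by (auto simp: lifts_def coeff_mult intro!: sum mult)

lemma lifts_pCons: "(u, a) \<in> G \<Longrightarrow> lifts q p \<Longrightarrow> lifts (pCons u q) (pCons a p)"
  by (auto simp: lifts_def coeff_pCons split: nat.splits)

lemma lifts_0: "lifts 0 0"
  by (auto simp: lifts_def zero_in)

lemma ex_lifts: "\<exists>q. lifts q p"
  by (induction p) (use lifts_0 lifts_pCons const in blast)+

text \<open>
  The images \<open>p\<close> of those \<open>q\<close> with \<open>q(u) = 0\<close> form an ideal of \<open>K[X]\<close>, which is proper unless \<open>u\<close>
  satisfies a relation whose image is \<open>1\<close>. A proper ideal has a zero \<open>\<alpha>\<close> in the algebraically closed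
  field \<open>K\<close>, and \<open>u \<mapsto> \<alpha>\<close> is a consistent choice.
\<close>

lemma extension_step:
  fixes u :: "'x \<Rightarrow> 'k"
  assumes closed: "\<And>p :: 'k poly. degree p > 0 \<Longrightarrow> \<exists>x. poly p x = 0"
    and no_rel: "\<not> (\<exists>q. lifts q 1 \<and> poly q u = 0)"
  shows "\<exists>G'. hom_graph G' \<and> G \<subseteq> G' \<and> u \<in> Domain G'"
proof -
  define I where "I = {p. \<exists>q. lifts q p \<and> poly q u = 0}"
  have I_add: "p + p' \<in> I" if "p \<in> I" "p' \<in> I" for p p'
    using that lifts_add unfolding I_def by fastforce
  have I_mult: "p' * p \<in> I" if "p \<in> I" for p p'
    using that ex_lifts[of p'] lifts_mult unfolding I_def by fastforce
  have "1 \<notin> I" using no_rel by (auto simp: I_def)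
  have "\<exists>\<alpha>. \<forall>p\<in>I. poly p \<alpha> = 0"
  proof (cases "I \<subseteq> {0}")
    case False
    then have "\<exists>g. g \<in> I \<and> g \<noteq> 0" by auto
    then obtain g where g: "g \<in> I" "g \<noteq> 0"
      and min: "\<And>h. h \<in> I \<Longrightarrow> h \<noteq> 0 \<Longrightarrow> degree g \<le> degree h"
      using ex_has_least_nat[of "\<lambda>g. g \<in> I \<and> g \<noteq> 0" _ degree] by blast
    have dvd: "g dvd p" if "p \<in> I" for p
    proof -
      have mod: "p mod g = p + (- (p div g)) * g"
        by (simp add: minus_div_mult_eq_mod[symmetric])
      have "p mod g \<in> I"
        unfolding mod by (rule I_add[OF that I_mult[OF g(1)]])
      then have "p mod g = 0"
        using min degree_mod_less[OF g(2), of p] by fastforce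
      then show ?thesis by (simp add: dvd_eq_mod_eq_0)
    qed
    have "degree g > 0"
    proof (rule ccontr)
      assume "\<not> degree g > 0"
      then obtain c where c: "g = [:c:]" by (metis degree_eq_zeroE gr0I)
      then have "[:inverse c:] * g = 1" using g(2) by (simp add: one_pCons)
      with I_mult[OF g(1), of "[:inverse c:]"] \<open>1 \<notin> I\<close> show False by simp
    qed
    with closed obtain \<alpha> where "poly g \<alpha> = 0" by blast
    with dvd have "\<forall>p\<in>I. poly p \<alpha> = 0"
      by (metis dvd_trans poly_eq_0_iff_dvd)
    then show ?thesis ..
  next
    case True
    then show ?thesis by (intro exI[of _ 0]) auto
  qed
  then obtain \<alpha> where \<alpha>: "\<And>p. p \<in> I \<Longrightarrow> poly p \<alpha> = 0" by blast
  define G' where "G' = {(poly q u, poly p \<alpha>) | q p. lifts q p}"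
  have sub: "(v, b) \<in> G'" if "(v, b) \<in> G" for v b
  proof -
    have "lifts [:v:] [:b:]" using lifts_pCons[OF that lifts_0] .
    moreover have "v = poly [:v:] u" "b = poly [:b:] \<alpha>" by simp_all
    ultimately show ?thesis unfolding G'_def by blast
  qed
  have "hom_graph G'"
  proof
    show "(\<lambda>_. c, c) \<in> G'" for c using sub const by blast
    fix v w :: "'x \<Rightarrow> 'k" and a b
    { assume "(v, a) \<in> G'" "(w, b) \<in> G'"
      then obtain q p q' p' where *: "v = poly q u" "a = poly p \<alpha>" "lifts q p"
        "w = poly q' u" "b = poly p' \<alpha>" "lifts q' p'"
        unfolding G'_def by blast
      have "v + w = poly (q + q') u" "a + b = poly (p + p') \<alpha>"
        "v * w = poly (q * q') u" "a * b = poly (p * p') \<alpha>"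
        using * by simp_all
      with lifts_add[OF *(3,6)] lifts_mult[OF *(3,6)]
      have "(v + w, a + b) \<in> G' \<and> (v * w, a * b) \<in> G'"
        unfolding G'_def by blast }
    then show "(v, a) \<in> G' \<Longrightarrow> (w, b) \<in> G' \<Longrightarrow> (v + w, a + b) \<in> G'"
      and "(v, a) \<in> G' \<Longrightarrow> (w, b) \<in> G' \<Longrightarrow> (v * w, a * b) \<in> G'" by blast+
    assume "(0, a) \<in> G'"
    then obtain q p where "poly q u = 0" "a = poly p \<alpha>" "lifts q p"
      unfolding G'_def by force
    then have "p \<in> I" by (auto simp: I_def)
    with \<alpha> \<open>a = poly p \<alpha>\<close> show "a = 0" by simp
  qed
  moreover have "(poly [:0, 1:] u, poly [:0, 1:] \<alpha>) \<in> G'"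
    unfolding G'_def using lifts_pCons[OF zero_in lifts_pCons[OF one_in lifts_0]] by blast
  then have "u \<in> Domain G'" by auto
  ultimately show ?thesis using sub by auto
qed

lemma poly_fun_apply:
  fixes u :: "'x \<Rightarrow> 'k"
  shows "poly q u x = (\<Sum>i\<le>degree q. coeff q i x * u x ^ i)"
  by (simp add: poly_altdef sum_fun_apply power_fun_apply)

lemma relation_degree_pos:
  fixes u :: "'x \<Rightarrow> 'k"
  assumes "lifts q 1" "poly q u = 0"
  shows "degree q > 0"
proof (rule ccontr)
  assume "\<not> degree q > 0"
  then obtain c where c: "q = [:c:]" by (metis degree_eq_zeroE gr0I)
  with assms have "c = 0" by simp
  with c assms(1) have "(0, 1) \<in> G" by (auto simp: lifts_def dest: spec[of _ 0])
  with zero show False by force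
qed

text \<open>
  Away from the zeros of \<open>u\<close>, a relation for the inverse of \<open>u\<close> becomes one for \<open>u\<close> after
  multiplication with a power of \<open>u\<close>.
\<close>

lemma reflect_relation:
  fixes u :: "'x \<Rightarrow> 'k"
  assumes rel: "poly r (\<lambda>x. inverse (u x)) = 0" and nz: "u x \<noteq> 0"
  shows "poly (reflect_poly r) u x = 0"
proof -
  let ?l = "degree r"
  have "poly (reflect_poly r) u x = (\<Sum>i\<le>?l. coeff (reflect_poly r) i x * u x ^ i)"
    unfolding poly_fun_apply
    by (rule sum.mono_neutral_left) (auto simp: degree_reflect_poly_le coeff_eq_0)
  also have "\<dots> = (\<Sum>i\<le>?l. coeff r (?l - i) x * u x ^ i)"
    by (auto simp: coeff_reflect_poly intro!: sum.cong)
  also have "\<dots> = (\<Sum>i\<le>?l. coeff r i x * u x ^ (?l - i))"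
    by (rule sum.reindex_bij_witness[where i = "\<lambda>i. ?l - i" and j = "\<lambda>i. ?l - i"]) auto
  also have "\<dots> = (\<Sum>i\<le>?l. u x ^ ?l * (coeff r i x * inverse (u x) ^ i))"
    using nz by (auto intro!: sum.cong simp: power_diff divide_simps)
  also have "\<dots> = u x ^ ?l * poly r (\<lambda>x. inverse (u x)) x"
    by (simp add: poly_fun_apply sum_distrib_left)
  finally show ?thesis using rel by simp
qed

text \<open>
  The step that makes a maximal homomorphism a valuation: if both \<open>u\<close> and its inverse satisfy a
  relation that obstructs an extension, then the longer one of the two can be shortened.
\<close>

lemma shorter_relation:
  fixes u :: "'x \<Rightarrow> 'k"
  assumes q: "lifts q 1" "poly q u = 0"
    and r: "lifts r 1" "poly r (\<lambda>x. inverse (u x)) = 0"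
    and le: "degree r \<le> degree q"
  shows "\<exists>q'. lifts q' 1 \<and> poly q' u = 0 \<and> degree q' < degree q"
proof -
  define k l where "k = degree q" and "l = degree r"
  \<comment> \<open>The second summand, \<open>r\<close> read backwards and multiplied by a power of \<open>u\<close>, cancels the top term
      of the first. Its value at \<open>u\<close> is zero wherever \<open>u\<close> is nonzero; the factor \<open>coeff q 0\<close> takes care
      of the zeros of \<open>u\<close>, where it equals \<open>q(u) = 0\<close>.\<close>
  define q' where "q' = Polynomial.smult (coeff q 0) (Polynomial.smult (coeff r 0) q - Polynomial.smult (coeff q k) (monom 1 (k - l) * reflect_poly r))"
  have kpos: "k > 0" unfolding k_def by (rule relation_degree_pos[OF q])
  have refl: "coeff (reflect_poly r) i = (if i > l then 0 else coeff r (l - i))" for i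
    by (simp add: coeff_reflect_poly l_def)
  have co: "coeff q' i = coeff q 0 * (coeff r 0 * coeff q i - coeff q k *
      (if i < k - l then 0 else coeff (reflect_poly r) (i - (k - l))))" for i
    by (simp add: q'_def coeff_monom_mult)
  have q0: "(coeff q 0, 1) \<in> G" and r0: "(coeff r 0, 1) \<in> G"
    and qk: "(coeff q k, 0) \<in> G" and qi: "(coeff q i, coeff 1 i) \<in> G" for i
    using q(1) r(1) kpos by (auto simp: lifts_def dest: spec[of _ 0] spec[of _ k])
  have "lifts q' 1"
    unfolding lifts_def
  proof
    fix i
    let ?c = "if i < k - l then 0 else coeff (reflect_poly r) (i - (k - l))"
    have "\<exists>b. (?c, b) \<in> G"
      using zero_in r(1) by (auto simp: refl lifts_def)
    then obtain b where b: "(?c, b) \<in> G" by blast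
    show "(coeff q' i, coeff 1 i) \<in> G"
      using mult[OF q0 diff[OF mult[OF r0 qi[of i]] mult[OF qk b]]] unfolding co by simp
  qed
  moreover have "poly q' u = 0"
  proof
    fix x
    have "poly q' u x = coeff q 0 x * (coeff r 0 x * poly q u x
        - coeff q k x * (poly (monom 1 (k - l)) u x * poly (reflect_poly r) u x))"
      by (simp add: q'_def)
    also have "\<dots> = 0"
    proof (cases "u x = 0")
      case True
      have "coeff q 0 x = poly q u x"
        unfolding poly_fun_apply using True by (simp add: power_0_left if_distrib[of "(*) _"] cong: if_cong)
      then show ?thesis using q(2) by simp
    next
      case False
      then show ?thesis using q(2) reflect_relation[OF r(2) False] by simp
    qed
    finally show "poly q' u x = 0 x" by simp
  qed
  moreover have "degree q' < k"
  proof -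
    have "coeff q' i = 0" if "i \<ge> k" for i
    proof (cases "i = k")
      case True
      then show ?thesis using le by (simp add: co refl k_def[symmetric] l_def[symmetric] mult.commute)
    next
      case False
      then show ?thesis using that le unfolding co refl k_def l_def by (auto simp: coeff_eq_0)
    qed
    then show ?thesis using kpos by (metis degree_0 leading_coeff_0_iff not_le_imp_less)
  qed
  ultimately show ?thesis by (auto simp: k_def)
qed

text \<open>
  A relation whose constant coefficient has value \<open>1\<close> and whose other coefficients have value \<open>0\<close>
  makes \<open>u\<close> infinite: after division by the highest power of \<open>u\<close> it shows that a power of the inverse of \<open>u\<close> has value \<open>0\<close>.
\<close>

lemma relation_value_eq_0:
  fixes u :: "'x \<Rightarrow> 'k"
  assumes q: "lifts q 1" "poly q u = 0" and v: "((\<lambda>x. inverse (u x)), b) \<in> G"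
  shows "b = 0"
proof -
  let ?v = "\<lambda>x. inverse (u x)" and ?k = "degree q"
  \<comment> \<open>The factor \<open>coeff q 0\<close> of value \<open>1\<close> makes the product vanish at the zeros of \<open>u\<close> as well.\<close>
  define s where "s = coeff q 0 * (\<Sum>i\<le>?k. coeff q i * ?v ^ (?k - i))"
  have "(coeff q 0, 1) \<in> G" using q(1) by (auto simp: lifts_def dest: spec[of _ 0])
  moreover have "(coeff q i, coeff 1 i) \<in> G" for i
    using q(1) by (auto simp: lifts_def)
  ultimately have s: "(s, 1 * (\<Sum>i\<le>?k. coeff 1 i * b ^ (?k - i))) \<in> G"
    unfolding s_def by (intro mult sum power v)
  have s0: "s = 0"
  proof
    fix x
    have s: "s x = coeff q 0 x * (\<Sum>i\<le>?k. coeff q i x * inverse (u x) ^ (?k - i))"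
      by (simp add: s_def sum_fun_apply power_fun_apply)
    show "s x = 0 x"
    proof (cases "u x = 0")
      case True
      have "coeff q 0 x = poly q u x"
        unfolding poly_fun_apply using True by (simp add: power_0_left if_distrib[of "(*) _"] cong: if_cong)
      then show ?thesis unfolding s using q(2) by simp
    next
      case False
      have "(\<Sum>i\<le>?k. coeff q i x * inverse (u x) ^ (?k - i)) = (\<Sum>i\<le>?k. inverse (u x) ^ ?k * (coeff q i x * u x ^ i))"
        using False by (intro sum.cong) (auto simp: power_diff divide_simps)
      also have "\<dots> = inverse (u x) ^ ?k * poly q u x"
        by (simp add: poly_fun_apply sum_distrib_left)
      finally show ?thesis unfolding s using q(2) by simp
    qed
  qed
  have "b ^ ?k = 0"
    using zero[OF s[unfolded s0]] by (simp add: coeff_1 if_distrib[of "\<lambda>c. c * _"] cong: if_cong)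
  then show ?thesis by simp
qed

end

text \<open>
  Every function has a value, or is infinite in the sense that its inverse has value \<open>0\<close>. Functions
  may have zeros; the inverse is then taken to be \<open>0\<close> there. Which sets of zeros are negligible is
  decided by the place itself, through the values \<open>0\<close> and \<open>1\<close> of idempotent functions, so that the
  algebra of all functions behaves like a field.
\<close>

locale place = hom_graph G for G :: "(('x \<Rightarrow> 'k::field) \<times> 'k) set" +
  assumes dichotomy: "u \<in> Domain G \<or> ((\<lambda>x. inverse (u x)), 0) \<in> G"

text \<open>
  The existence theorem for valuation rings that dominate a given ring, for rings of functions. By
  Zorn's lemma there is a maximal homomorphism. A function outside its domain satisfies a relation, by
  \<open>extension_step\<close>, and relations of least degree for \<open>u\<close> and its inverse contradict
  \<open>shorter_relation\<close>.
\<close>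

theorem hom_graph_extends_to_place:
  fixes G0 :: "(('x \<Rightarrow> 'k::alg_closed_field) \<times> 'k) set"
  assumes "hom_graph G0"
  shows "\<exists>G. place G \<and> G0 \<subseteq> G"
proof -
  define \<A> where "\<A> = {G. hom_graph G \<and> G0 \<subseteq> G}"
  have "\<exists>M\<in>\<A>. \<forall>X\<in>\<A>. M \<subseteq> X \<longrightarrow> X = M"
  proof (rule subset_Zorn_nonempty)
    show "\<A> \<noteq> {}" using assms by (auto simp: \<A>_def)
    fix \<C> assume ne: "\<C> \<noteq> {}" and chain: "subset.chain \<A> \<C>"
    have hom: "hom_graph X" "G0 \<subseteq> X" if "X \<in> \<C>" for X
      using chain that by (auto simp: \<A>_def subset.chain_def)
    have common: "\<exists>X\<in>\<C>. p \<in> X \<and> p' \<in> X" if pp: "p \<in> \<Union>\<C>" "p' \<in> \<Union>\<C>" for p p'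
    proof -
      obtain X Y where XY: "X \<in> \<C>" "p \<in> X" "Y \<in> \<C>" "p' \<in> Y" using pp by blast
      with chain have "X \<subseteq> Y \<or> Y \<subseteq> X" by (simp add: subset_chain_def)
      with XY show ?thesis by blast
    qed
    have "hom_graph (\<Union>\<C>)"
    proof
      show "(\<lambda>_. c, c) \<in> \<Union>\<C>" for c
        using ne hom(1) hom_graph.const[of _ c] by blast
      show "(u + v, a + b) \<in> \<Union>\<C>" if "(u, a) \<in> \<Union>\<C>" "(v, b) \<in> \<Union>\<C>" for u a v b
        using common[OF that] hom(1) hom_graph.add[of _ u a v b] by blast
      show "(u * v, a * b) \<in> \<Union>\<C>" if "(u, a) \<in> \<Union>\<C>" "(v, b) \<in> \<Union>\<C>" for u a v b
        using common[OF that] hom(1) hom_graph.mult[of _ u a v b] by blast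
      show "a = 0" if "(0, a) \<in> \<Union>\<C>" for a
        using that hom(1) hom_graph.zero[of _ a] by blast
    qed
    then show "\<Union>\<C> \<in> \<A>" using ne hom by (auto simp: \<A>_def)
  qed
  then obtain G where G: "hom_graph G" "G0 \<subseteq> G"
    and maximal: "\<And>X. hom_graph X \<Longrightarrow> G \<subseteq> X \<Longrightarrow> X = G"
    unfolding \<A>_def by auto
  interpret hom_graph G by fact
  have relation: "\<exists>q. lifts q 1 \<and> poly q u = 0" if "u \<notin> Domain G" for u
    using extension_step[of u] alg_closed_imp_poly_has_root maximal that by blast
  have "u \<in> Domain G \<or> ((\<lambda>x. inverse (u x)), 0) \<in> G" for u
  proof (rule ccontr)
    assume neither: "\<not> ?thesis"
    define v where "v = (\<lambda>x. inverse (u x))"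
    have u_v: "u = (\<lambda>x. inverse (v x))" by (simp add: v_def)
    have rel_u: "\<exists>q. lifts q 1 \<and> poly q u = 0" using relation neither by blast
    then have "v \<notin> Domain G"
      using relation_value_eq_0 neither unfolding v_def by blast
    then have rel_v: "\<exists>r. lifts r 1 \<and> poly r v = 0" using relation by blast
    obtain q where q: "lifts q 1" "poly q u = 0"
      "\<And>q'. lifts q' 1 \<Longrightarrow> poly q' u = 0 \<Longrightarrow> degree q \<le> degree q'"
      using rel_u ex_has_least_nat[of "\<lambda>q. lifts q 1 \<and> poly q u = 0" _ degree] by blast
    obtain r where r: "lifts r 1" "poly r v = 0"
      "\<And>r'. lifts r' 1 \<Longrightarrow> poly r' v = 0 \<Longrightarrow> degree r \<le> degree r'"
      using rel_v ex_has_least_nat[of "\<lambda>q. lifts q 1 \<and> poly q v = 0" _ degree] by blast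
    show False
    proof (cases "degree r \<le> degree q")
      case True
      with shorter_relation[OF q(1,2) r(1)] r(2) q(3) show False
        unfolding v_def by (meson not_le)
    next
      case False
      then show False
        using shorter_relation[OF r(1,2) q(1)] q(2) r(3) unfolding u_v[symmetric]
        by (meson nle_le not_le)
    qed
  qed
  then have "place G" by unfold_locales
  with G show ?thesis by blast
qed

context place
begin

lemma idempotent_value:
  assumes "(e, a) \<in> G" "e * e = e"
  shows "a = 0 \<or> a = 1"
  using unique[OF mult[OF assms(1,1)], of a] assms by auto

definition supp :: "('x \<Rightarrow> 'k) \<Rightarrow> 'x \<Rightarrow> 'k"
  where "supp u = (\<lambda>x. if u x = 0 then 0 else 1)"

lemma mult_inverse_eq_supp: "(\<lambda>x. u x * inverse (u x)) = supp u"
  by (auto simp: supp_def)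

lemma supp_in_Domain: "supp u \<in> Domain G"
proof -
  have "(\<lambda>x. inverse (supp u x)) = supp u" by (auto simp: fun_eq_iff supp_def)
  with dichotomy[of "supp u"] show ?thesis by auto
qed

text \<open>
  A set on which functions are negligible: if its indicator \<open>e\<close> has value \<open>0\<close>, then so has every
  multiple of \<open>e\<close>, even of a function of infinite value. For otherwise \<open>e * u + (1 - e)\<close> would be
  infinite, although it agrees with \<open>1\<close> where \<open>e\<close> vanishes.
\<close>

lemma idempotent_annihilates:
  assumes e: "(e, 0) \<in> G" "e * e = e"
  shows "(e * u, 0) \<in> G"
proof -
  have e01: "e x = 0 \<or> e x = 1" for x
    using fun_cong[OF e(2), of x] by auto
  let ?w = "\<lambda>x. e x * u x + (1 - e x)"
  have "?w \<in> Domain G"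
  proof (rule ccontr)
    assume "\<not> ?thesis"
    with dichotomy have "((\<lambda>x. inverse (?w x)), 0) \<in> G" by blast
    from mult[OF diff[OF one_in e(1)] this]
    have "((1 - e) * (\<lambda>x. inverse (?w x)), 0) \<in> G" by simp
    also have "(1 - e) * (\<lambda>x. inverse (?w x)) = 1 - e"
    proof
      show "((1 - e) * (\<lambda>x. inverse (?w x))) x = (1 - e) x" for x
        using e01[of x] by (elim disjE) simp_all
    qed
    finally show False using diff[OF one_in e(1)] unique by fastforce
  qed
  then obtain a where "(?w, a) \<in> G" by blast
  from mult[OF e(1) this] have "(e * ?w, 0) \<in> G" by simp
  also have "e * ?w = e * u"
  proof
    show "(e * ?w) x = (e * u) x" for x
      using e01[of x] by (elim disjE) simp_all
  qed
  finally show ?thesis .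
qed

lemma not_infinitesimal:
  assumes u: "(u, 0) \<notin> G"
  shows "(\<lambda>x. inverse (u x)) \<in> Domain G" and "(supp u, 1) \<in> G"
proof -
  show "(\<lambda>x. inverse (u x)) \<in> Domain G"
    using dichotomy[of "\<lambda>x. inverse (u x)"] u by auto
  obtain a where a: "(supp u, a) \<in> G" using supp_in_Domain by blast
  have idem: "supp u * supp u = supp u" by (auto simp: fun_eq_iff supp_def)
  have "a \<noteq> 0"
  proof
    assume "a = 0"
    with a idempotent_annihilates[OF _ idem, of u] have "(supp u * u, 0) \<in> G" by simp
    also have "supp u * u = u" by (auto simp: fun_eq_iff supp_def)
    finally show False using u by simp
  qed
  with idempotent_value[OF a idem] a show "(supp u, 1) \<in> G" by auto
qed

text \<open>
  The valuation of a place is a total order, so a finite family has a member that divides all others;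
  it serves as the pivot.
\<close>

lemma ex_dominant:
  assumes "finite A" and "\<exists>i\<in>A. (u i, 0) \<notin> G"
  shows "\<exists>j\<in>A. (u j, 0) \<notin> G \<and> (\<forall>i\<in>A. (\<lambda>x. u i x * inverse (u j x)) \<in> Domain G)"
  using assms
proof (induction A rule: finite_induct)
  case (insert i A)
  show ?case
  proof (cases "\<exists>i\<in>A. (u i, 0) \<notin> G")
    case False
    then have ui: "(u i, 0) \<notin> G" and A: "\<And>j. j \<in> A \<Longrightarrow> (u j, 0) \<in> G"
      using insert.prems by auto
    obtain b where "((\<lambda>x. inverse (u i x)), b) \<in> G" using not_infinitesimal(1)[OF ui] by blast
    then have "(\<lambda>x. u j x * inverse (u i x)) \<in> Domain G" if "j \<in> A" for j
      using mult[OF A[OF that]] by (auto simp: times_fun_def)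
    then show ?thesis using ui supp_in_Domain[of "u i"] by (intro bexI[of _ i]) (auto simp: mult_inverse_eq_supp)
  next
    case True
    with insert.IH obtain j where j: "j \<in> A" "(u j, 0) \<notin> G"
      and dom: "\<And>k. k \<in> A \<Longrightarrow> (\<lambda>x. u k x * inverse (u j x)) \<in> Domain G" by blast
    show ?thesis
    proof (cases "(\<lambda>x. u i x * inverse (u j x)) \<in> Domain G")
      case True
      then show ?thesis using j dom by (intro bexI[of _ j]) auto
    next
      case False
      with dichotomy have ji: "((\<lambda>x. inverse (u i x * inverse (u j x))), 0) \<in> G" by blast
      have ui: "(u i, 0) \<notin> G"
      proof
        assume "(u i, 0) \<in> G"
        moreover obtain b where "((\<lambda>x. inverse (u j x)), b) \<in> G" using not_infinitesimal(1)[OF j(2)] by blast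
        ultimately have "(u i * (\<lambda>x. inverse (u j x)), 0 * b) \<in> G" by (rule mult)
        with False show False by (auto simp: times_fun_def)
      qed
      have "(\<lambda>x. u k x * inverse (u i x)) \<in> Domain G" if k: "k \<in> A" for k
      proof -
        obtain b where b: "((\<lambda>x. u k x * inverse (u j x)), b) \<in> G" using dom[OF k] by blast
        have e: "(1 - supp (u j), 0) \<in> G"
          using diff[OF one_in not_infinitesimal(2)[OF j(2)]] by simp
        have "(1 - supp (u j)) * (1 - supp (u j)) = 1 - supp (u j)"
          by (auto simp: fun_eq_iff supp_def)
        from idempotent_annihilates[OF e this, of "\<lambda>x. u k x * inverse (u i x)"]
        have "((1 - supp (u j)) * (\<lambda>x. u k x * inverse (u i x)), 0) \<in> G" .
        from add[OF mult[OF b ji] this]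
        have "((\<lambda>x. u k x * inverse (u j x)) * (\<lambda>x. inverse (u i x * inverse (u j x)))
            + (1 - supp (u j)) * (\<lambda>x. u k x * inverse (u i x)), 0) \<in> G" by simp
        also have "(\<lambda>x. u k x * inverse (u j x)) * (\<lambda>x. inverse (u i x * inverse (u j x)))
            + (1 - supp (u j)) * (\<lambda>x. u k x * inverse (u i x)) = (\<lambda>x. u k x * inverse (u i x))"
        proof
          fix x
          show "((\<lambda>x. u k x * inverse (u j x)) * (\<lambda>x. inverse (u i x * inverse (u j x)))
            + (1 - supp (u j)) * (\<lambda>x. u k x * inverse (u i x))) x = u k x * inverse (u i x)"
            by (cases "u j x = 0") (auto simp: supp_def field_simps)
        qed
        finally show ?thesis by blast
      qed
      then show ?thesis using ui supp_in_Domain[of "u i"] by (intro bexI[of _ i]) (auto simp: mult_inverse_eq_supp)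
    qed
  qed
qed simp

end

section \<open>Gaussian elimination over a place\<close>

context place
begin

text \<open>
  The columns \<open>L c\<close>, for \<open>c\<close> in \<open>C\<close>, form a matrix of functions. A limit pair consists of the value
  \<open>\<eta>\<close> of a finite vector \<open>y\<close> and the value \<open>\<omega>\<close> of its image \<open>L y\<close>, provided that the image is finite
  too. The limit pairs form a linear relation, the limit of the graph of \<open>L\<close>.
\<close>

definition limit_pair ::
    "nat \<Rightarrow> 'c set \<Rightarrow> ('c \<Rightarrow> nat \<Rightarrow> 'x \<Rightarrow> 'k) \<Rightarrow> ('c \<Rightarrow> 'k) \<Rightarrow> (nat \<Rightarrow> 'k) \<Rightarrow> bool"
  where "limit_pair n C L \<eta> \<omega> \<longleftrightarrow>
    (\<exists>y. (\<forall>c\<in>C. (y c, \<eta> c) \<in> G) \<and> (\<forall>i<n. ((\<Sum>c\<in>C. y c * L c i), \<omega> i) \<in> G))"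

lemma limit_pair_zero: "limit_pair n C L (\<lambda>_. 0) (\<lambda>_. 0)"
  unfolding limit_pair_def using zero_in by (intro exI[of _ "\<lambda>_. 0"]) simp

lemma limit_pair_add:
  assumes "limit_pair n C L \<eta> \<omega>" "limit_pair n C L \<eta>' \<omega>'"
  shows "limit_pair n C L (\<lambda>c. \<eta> c + \<eta>' c) (\<lambda>i. \<omega> i + \<omega>' i)"
proof -
  obtain y y' where
    "\<forall>c\<in>C. (y c, \<eta> c) \<in> G" "\<forall>i<n. ((\<Sum>c\<in>C. y c * L c i), \<omega> i) \<in> G"
    "\<forall>c\<in>C. (y' c, \<eta>' c) \<in> G" "\<forall>i<n. ((\<Sum>c\<in>C. y' c * L c i), \<omega>' i) \<in> G"
    using assms unfolding limit_pair_def by blast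
  then show ?thesis
    unfolding limit_pair_def
    by (intro exI[of _ "\<lambda>c. y c + y' c"]) (simp add: add distrib_right sum.distrib)
qed

lemma limit_pair_scale:
  assumes "limit_pair n C L \<eta> \<omega>"
  shows "limit_pair n C L (\<lambda>c. a * \<eta> c) (\<lambda>i. a * \<omega> i)"
proof -
  obtain y where "\<forall>c\<in>C. (y c, \<eta> c) \<in> G" "\<forall>i<n. ((\<Sum>c\<in>C. y c * L c i), \<omega> i) \<in> G"
    using assms unfolding limit_pair_def by blast
  then show ?thesis
    unfolding limit_pair_def
    by (intro exI[of _ "\<lambda>c. (\<lambda>_. a) * y c"])
      (simp add: mult const mult.assoc sum_distrib_left[symmetric])
qed

lemma limit_pair_sum:
  assumes "finite S" "\<And>s. s \<in> S \<Longrightarrow> limit_pair n C L (\<eta> s) (\<omega> s)"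
  shows "limit_pair n C L (\<lambda>c. \<Sum>s\<in>S. a s * \<eta> s c) (\<lambda>i. \<Sum>s\<in>S. a s * \<omega> s i)"
  using assms
proof (induction S rule: finite_induct)
  case (insert x S)
  have "limit_pair n C L (\<lambda>c. a x * \<eta> x c + (\<Sum>s\<in>S. a s * \<eta> s c))
      (\<lambda>i. a x * \<omega> x i + (\<Sum>s\<in>S. a s * \<omega> s i))"
    by (rule limit_pair_add[OF limit_pair_scale]) (use insert in auto)
  then show ?case using insert.hyps by simp
qed (simp add: limit_pair_zero)

lemma limit_pair_cong:
  assumes "limit_pair n C L \<eta> \<omega>" "\<And>c. c \<in> C \<Longrightarrow> \<eta> c = \<eta>' c" "\<And>i. i < n \<Longrightarrow> \<omega> i = \<omega>' i"
  shows "limit_pair n C L \<eta>' \<omega>'"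
  using assms unfolding limit_pair_def by auto

lemma limit_pair_unit:
  assumes "finite C" "c \<in> C" "(p, a) \<in> G" "\<And>i. i < n \<Longrightarrow> (p * L c i, \<omega> i) \<in> G"
  shows "limit_pair n C L (\<lambda>c'. if c' = c then a else 0) \<omega>"
  unfolding limit_pair_def
proof (intro exI[of _ "\<lambda>c'. if c' = c then p else 0"] conjI ballI allI impI)
  fix i assume "i < n"
  have "(\<Sum>c'\<in>C. (if c' = c then p else 0) * L c' i) = p * L c i"
    using assms(1,2) by (simp add: if_distrib[of "\<lambda>p. p * _"] cong: if_cong)
  then show "((\<Sum>c'\<in>C. (if c' = c then p else 0) * L c' i), \<omega> i) \<in> G"
    using assms(4)[OF \<open>i < n\<close>] by simp
qed (use assms zero_in in auto)

text \<open>
  A limit pair for the matrix after a column operation is one for the original matrix: put the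
  coefficient that was subtracted into the coordinate of the pivot column.
\<close>

lemma limit_pair_column_operation:
  assumes C: "finite C" "j \<notin> C" and t: "\<And>c. c \<in> C \<Longrightarrow> t c \<in> Domain G"
    and lim: "limit_pair n C (\<lambda>c i. L c i - t c * L j i) \<eta> \<omega>"
  shows "\<exists>b. limit_pair n (insert j C) L (\<eta>(j := b)) \<omega>"
proof -
  obtain y where y: "\<forall>c\<in>C. (y c, \<eta> c) \<in> G"
    "\<forall>i<n. ((\<Sum>c\<in>C. y c * (L c i - t c * L j i)), \<omega> i) \<in> G"
    using lim unfolding limit_pair_def by blast
  have "\<exists>a. c \<in> C \<longrightarrow> (t c, a) \<in> G" for c using t[of c] by auto
  then obtain \<tau> where \<tau>: "\<And>c. c \<in> C \<Longrightarrow> (t c, \<tau> c) \<in> G" by metis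
  define s b where "s = - (\<Sum>c\<in>C. y c * t c)" and "b = - (\<Sum>c\<in>C. \<eta> c * \<tau> c)"
  have s: "(s, b) \<in> G"
    unfolding s_def b_def using y(1) \<tau> by (intro uminus sum mult) auto
  have yj: "(\<Sum>c\<in>C. (y(j := s)) c * L c i) = (\<Sum>c\<in>C. y c * L c i)" for i
    using C by (intro sum.cong) auto
  have eq: "(\<Sum>c\<in>insert j C. (y(j := s)) c * L c i) = (\<Sum>c\<in>C. y c * (L c i - t c * L j i))" for i
    unfolding sum.insert[OF C] yj
    by (simp add: s_def right_diff_distrib sum_subtractf sum_distrib_right mult.assoc)
  have "limit_pair n (insert j C) L (\<eta>(j := b)) \<omega>"
    unfolding limit_pair_def
    by (rule exI[of _ "y(j := s)"], unfold eq) (use y s C in auto)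
  then show ?thesis ..
qed

text \<open>
  A Smith normal form with respect to a place, as a statement about limit pairs. The limit of the
  graph of \<open>L\<close> has dimension at least \<open>card C\<close>. The columns outside \<open>J\<close> yield, in reduced form, limit
  pairs with second component \<open>0\<close>, and the pivot columns in \<open>J\<close> yield limit pairs whose second
  components are independent, in reduced form with respect to the pivot rows \<open>\<rho>\<close>. The pivot is an
  entry that dominates all others; if all entries are infinitesimal, every finite vector has
  infinitesimal image.
\<close>

theorem elimination:
  fixes L :: "'c \<Rightarrow> nat \<Rightarrow> 'x \<Rightarrow> 'k"
  assumes "finite C"
  shows "\<exists>J \<rho> \<beta> \<zeta> w. J \<subseteq> C \<and> inj_on \<rho> J \<and> \<rho> ` J \<subseteq> {..<n} \<and>
    (\<forall>c\<in>C - J. limit_pair n C L (\<lambda>c'. if c' \<in> J then \<beta> c c' else if c' = c then 1 else 0) (\<lambda>_. 0)) \<and>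
    (\<forall>j\<in>J. limit_pair n C L (\<zeta> j) (w j) \<and> (\<forall>k\<in>J. w j (\<rho> k) = (if k = j then 1 else 0)))"
  using assms
proof (induction "card C" arbitrary: C L)
  case 0
  then have "C = {}" by simp
  then show ?case by (intro exI[of _ "{}"]) auto
next
  case (Suc N)
  note C = \<open>finite C\<close>
  show ?case
  proof (cases "\<forall>c\<in>C. \<forall>i<n. (L c i, 0) \<in> G")
    case True
    have "limit_pair n C L (\<lambda>c'. if c' = c then 1 else 0) (\<lambda>_. 0)" if "c \<in> C" for c
      by (rule limit_pair_unit[OF C that one_in]) (use True that in auto)
    then show ?thesis by (intro exI[of _ "{}"]) auto
  next
    case False
    then obtain j i0 where j: "j \<in> C" "i0 < n" "(L j i0, 0) \<notin> G"
      and dominant: "\<And>c i. c \<in> C \<Longrightarrow> i < n \<Longrightarrow> (\<lambda>x. L c i x * inverse (L j i0 x)) \<in> Domain G"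
      using ex_dominant[of "C \<times> {..<n}" "\<lambda>(c, i). L c i"] C by fastforce
    define p where "p = (\<lambda>x. inverse (L j i0 x))"
    obtain a where p: "(p, a) \<in> G"
      using not_infinitesimal(1)[OF j(3)] unfolding p_def by blast
    have one: "(L j i0 * p, 1) \<in> G"
      using not_infinitesimal(2)[OF j(3)] unfolding p_def mult_inverse_eq_supp[symmetric] times_fun_def .
    \<comment> \<open>The multiplier that clears the entry of column \<open>c\<close> in the pivot row. It is finite, because the
        pivot dominates, so that the column operation preserves finite vectors.\<close>
    define t where "t c = L c i0 * p" for c
    have t: "t c \<in> Domain G" if "c \<in> C" for c
      using dominant[OF that j(2)] by (simp add: t_def p_def times_fun_def)
    define C' where "C' = C - {j}"
    have C': "finite C'" "j \<notin> C'" "C = insert j C'" "card C' = N" "C' \<subseteq> C"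
      using C j Suc.hyps(2) by (auto simp: C'_def)
    define L' where "L' c i = L c i - t c * L j i" for c i
    have L'0: "(L' c i0, 0) \<in> G" for c
    proof -
      have "(1 - L j i0 * p, 0) \<in> G" using diff[OF one_in one] by simp
      moreover have "(1 - L j i0 * p) * (1 - L j i0 * p) = 1 - L j i0 * p"
        by (auto simp: fun_eq_iff p_def)
      ultimately have "((1 - L j i0 * p) * L c i0, 0) \<in> G" by (rule idempotent_annihilates)
      then show ?thesis by (simp add: L'_def t_def algebra_simps)
    qed
    from Suc.hyps(1)[OF C'(4)[symmetric] C'(1), of L']
    obtain J \<rho> \<beta> \<zeta> w where J_\<rho>: "J \<subseteq> C'" "inj_on \<rho> J" "\<rho> ` J \<subseteq> {..<n}"
      and free: "\<forall>c\<in>C' - J. limit_pair n C' L' (\<lambda>c'. if c' \<in> J then \<beta> c c' else if c' = c then 1 else 0) (\<lambda>_. 0)"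
      and piv: "\<forall>k\<in>J. limit_pair n C' L' (\<zeta> k) (w k) \<and> (\<forall>l\<in>J. w k (\<rho> l) = (if l = k then 1 else 0))"
      by (elim exE conjE)
    note IH = J_\<rho> bspec[OF free] conjunct1[OF bspec[OF piv]] bspec[OF conjunct2[OF bspec[OF piv]]]
    have w0: "w k i0 = 0" if k: "k \<in> J" for k
    proof -
      obtain y where y: "\<forall>c\<in>C'. (y c, \<zeta> k c) \<in> G" "((\<Sum>c\<in>C'. y c * L' c i0), w k i0) \<in> G"
        using IH(5)[OF k] j(2) unfolding limit_pair_def by blast
      have "((\<Sum>c\<in>C'. y c * L' c i0), (\<Sum>c\<in>C'. \<zeta> k c * 0)) \<in> G"
        using y(1) L'0 by (intro sum mult) auto
      with y(2) unique show ?thesis by fastforce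
    qed
    have \<rho>_i0: "\<rho> k \<noteq> i0" if "k \<in> J" for k
      using w0[OF that] IH(6)[OF that that] by auto
    have lift: "\<exists>b. limit_pair n C L (\<eta>(j := b)) \<omega>" if "limit_pair n C' L' \<eta> \<omega>" for \<eta> \<omega>
      unfolding C'(3)
      by (rule limit_pair_column_operation[OF C'(1,2)]) (use that t C' in \<open>auto simp: L'_def[abs_def]\<close>)
    define \<beta>' where "\<beta>' c = (\<beta> c)(j := SOME b. limit_pair n C L
        ((\<lambda>c'. if c' \<in> J then \<beta> c c' else if c' = c then 1 else 0)(j := b)) (\<lambda>_. 0))" for c
    define \<zeta>' where "\<zeta>' k = (\<zeta> k)(j := SOME b. limit_pair n C L ((\<zeta> k)(j := b)) (w k))" for k
    have \<beta>': "limit_pair n C L (\<lambda>c'. if c' \<in> insert j J then \<beta>' c c' else if c' = c then 1 else 0) (\<lambda>_. 0)"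
      if c: "c \<in> C' - J" for c
      by (rule limit_pair_cong[OF someI_ex[OF lift[OF IH(4)[OF c]]]])
        (use IH(1) C' c in \<open>auto simp: \<beta>'_def\<close>)
    have \<zeta>': "limit_pair n C L (\<zeta>' k) (w k)" if k: "k \<in> J" for k
      unfolding \<zeta>'_def by (rule someI_ex[OF lift[OF IH(5)[OF k]]])
    have "\<exists>b. i < n \<longrightarrow> (p * L j i, b) \<in> G" for i
      using dominant[OF j(1), of i] by (auto simp: p_def times_fun_def mult.commute)
    then obtain v where v: "\<And>i. i < n \<Longrightarrow> (p * L j i, v i) \<in> G" by metis
    have v1: "v i0 = 1" using unique[OF v[OF j(2)]] one by (simp add: mult.commute)
    define \<eta>0 where "\<eta>0 = (\<lambda>c'. if c' = j then a else 0)"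
    have \<eta>0: "limit_pair n C L \<eta>0 v"
      unfolding \<eta>0_def by (rule limit_pair_unit[OF C j(1) p]) (rule v)
    \<comment> \<open>The vector that belongs to the new pivot, corrected so that the limit of its image is zero in
        the rows of the other pivots.\<close>
    define \<zeta>j where "\<zeta>j = (\<lambda>c. \<eta>0 c + (\<Sum>k\<in>J. - v (\<rho> k) * \<zeta>' k c))"
    define wj where "wj = (\<lambda>i. v i + (\<Sum>k\<in>J. - v (\<rho> k) * w k i))"
    have J: "finite J" "j \<notin> J" using IH(1) C'(1,2) finite_subset by auto
    have new: "limit_pair n C L \<zeta>j wj"
      unfolding \<zeta>j_def wj_def by (intro limit_pair_add \<eta>0 limit_pair_sum J(1) \<zeta>')
    have wj_i0: "wj i0 = 1" by (simp add: wj_def v1 w0)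
    have wj_\<rho>: "wj (\<rho> l) = 0" if l: "l \<in> J" for l
    proof -
      have "(\<Sum>k\<in>J. - v (\<rho> k) * w k (\<rho> l)) = (\<Sum>k\<in>J. if k = l then - v (\<rho> l) else 0)"
        by (intro sum.cong) (auto simp: IH(6) l)
      then show ?thesis using l J(1) by (simp add: wj_def)
    qed
    show ?thesis
    proof (rule exI[of _ "insert j J"], rule exI[of _ "\<rho>(j := i0)"], rule exI[of _ \<beta>'],
        rule exI[of _ "\<zeta>'(j := \<zeta>j)"], rule exI[of _ "w(j := wj)"], intro conjI ballI)
      show "insert j J \<subseteq> C" using IH(1) C' j by auto
      have "\<rho> k = (\<rho>(j := i0)) k" if "k \<in> J" for k using that J by auto
      then have "inj_on (\<rho>(j := i0)) J" using IH(2) inj_on_cong by blast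
      then show "inj_on (\<rho>(j := i0)) (insert j J)"
        using J \<rho>_i0 by (auto simp: inj_on_insert)
      show "(\<rho>(j := i0)) ` insert j J \<subseteq> {..<n}"
        using IH(3) j(2) J by auto
      show "limit_pair n C L (\<lambda>c'. if c' \<in> insert j J then \<beta>' c c' else if c' = c then 1 else 0) (\<lambda>_. 0)"
        if "c \<in> C - insert j J" for c
        using \<beta>'[of c] that by (auto simp: C'_def)
      show "limit_pair n C L ((\<zeta>'(j := \<zeta>j)) k) ((w(j := wj)) k)" if "k \<in> insert j J" for k
        using that new \<zeta>' J by auto
      show "(w(j := wj)) k ((\<rho>(j := i0)) l) = (if l = k then 1 else 0)"
        if "k \<in> insert j J" "l \<in> insert j J" for k l
        using that J w0 wj_i0 wj_\<rho> IH(6) by auto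
    qed
  qed
qed

end

section \<open>Tensors as forms\<close>

text \<open>
  The polynomial function of degree \<open>d\<close> that corresponds to a tensor. Its monomials are indexed by
  multisets, and the coefficient of a monomial collects all entries of the tensor whose index lists
  are arrangements of the multiset.
\<close>

definition form :: "nat \<Rightarrow> nat \<Rightarrow> 'a::comm_ring_1 tensor \<Rightarrow> (nat \<Rightarrow> 'a) \<Rightarrow> 'a"
  where "form n d T x = (\<Sum>is\<in>tensor_index n d. T is * (\<Prod>k<d. x (is ! k)))"

definition index_msets :: "nat \<Rightarrow> nat \<Rightarrow> nat multiset set"
  where "index_msets n d = mset ` tensor_index n d"

definition mset_coeff :: "nat \<Rightarrow> nat \<Rightarrow> nat multiset \<Rightarrow> 'a::comm_ring_1 tensor \<Rightarrow> 'a"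
  where "mset_coeff n d M T = (\<Sum>is\<in>{is \<in> tensor_index n d. mset is = M}. T is)"

lemma finite_index_msets: "finite (index_msets n d)"
  unfolding index_msets_def by (intro finite_imageI finite_tensor_index)

lemma index_msets_iff: "M \<in> index_msets n d \<longleftrightarrow> size M = d \<and> set_mset M \<subseteq> {..<n}"
proof
  assume "size M = d \<and> set_mset M \<subseteq> {..<n}"
  moreover obtain xs where "M = mset xs" by (metis ex_mset)
  ultimately show "M \<in> index_msets n d" by (auto simp: index_msets_def tensor_index_def)
qed (auto simp: index_msets_def tensor_index_def)

lemma sum_tensor_index_by_mset:
  "(\<Sum>is\<in>tensor_index n d. f is) = (\<Sum>M\<in>index_msets n d. \<Sum>is\<in>{is \<in> tensor_index n d. mset is = M}. f is)"
  unfolding index_msets_def by (rule sum.image_gen[OF finite_tensor_index])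

lemma prod_nth_eq_prod_mset: "(\<Prod>k<length is. x (is ! k)) = (\<Prod>i\<in>#mset is. x i)"
  by (induction "is") (simp_all add: prod.lessThan_Suc_shift del: prod.lessThan_Suc)

lemma form_eq_sum_monomials:
  "form n d T x = (\<Sum>M\<in>index_msets n d. mset_coeff n d M T * (\<Prod>i\<in>#M. x i))"
  unfolding form_def sum_tensor_index_by_mset mset_coeff_def sum_distrib_right
  by (intro sum.cong refl) (auto simp: tensor_index_def prod_nth_eq_prod_mset[symmetric])

lemma sum_prod_tensor_index:
  fixes g :: "nat \<Rightarrow> nat \<Rightarrow> 'a::comm_semiring_1"
  shows "(\<Sum>is\<in>tensor_index n d. \<Prod>k<d. g k (is ! k)) = (\<Prod>k<d. \<Sum>i<n. g k i)"
proof -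
  have bij: "bij_betw (\<lambda>g. map g [0..<d]) (PiE {..<d} (\<lambda>_. {..<n})) (tensor_index n d)"
  proof (rule bij_betw_byWitness[where f' = "\<lambda>is. restrict (\<lambda>k. is ! k) {..<d}"])
    show "\<forall>g\<in>PiE {..<d} (\<lambda>_. {..<n}). restrict (\<lambda>k. map g [0..<d] ! k) {..<d} = g"
      by (auto simp: fun_eq_iff PiE_def extensional_def restrict_def)
    show "\<forall>is\<in>tensor_index n d. map (restrict ((!) is) {..<d}) [0..<d] = is"
      by (auto simp: tensor_index_def intro: nth_equalityI)
    show "(\<lambda>g. map g [0..<d]) ` PiE {..<d} (\<lambda>_. {..<n}) \<subseteq> tensor_index n d"
      by (auto simp: tensor_index_def PiE_def Pi_def)
    show "(\<lambda>is. restrict ((!) is) {..<d}) ` tensor_index n d \<subseteq> PiE {..<d} (\<lambda>_. {..<n})"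
      by (auto simp: tensor_index_def PiE_def Pi_def set_conv_nth)
  qed
  have "(\<Sum>is\<in>tensor_index n d. \<Prod>k<d. g k (is ! k)) =
      (\<Sum>h\<in>PiE {..<d} (\<lambda>_. {..<n}). \<Prod>k<d. g k (h k))"
    by (subst sum.reindex_bij_betw[OF bij, symmetric]) simp
  also have "\<dots> = (\<Prod>k<d. \<Sum>i<n. g k i)"
    by (subst prod_sum_PiE) auto
  finally show ?thesis .
qed

text \<open>
  A multiset of size \<open>d\<close> has at most \<open>d!\<close> arrangements.
\<close>

lemma card_index_msets: "n ^ d \<le> fact d * card (index_msets n d)"
proof -
  have "n ^ d = card (tensor_index n d)"
    using card_lists_length_eq[of "{..<n}" d] by (simp add: tensor_index_def conj_commute)
  also have "\<dots> = (\<Sum>M\<in>index_msets n d. card {is \<in> tensor_index n d. mset is = M})"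
    using sum_tensor_index_by_mset[of "\<lambda>_. 1 :: nat" n d] by simp
  also have "\<dots> \<le> (\<Sum>M\<in>index_msets n d. fact d)"
  proof (rule sum_mono)
    fix M assume M: "M \<in> index_msets n d"
    have "card {is \<in> tensor_index n d. mset is = M} \<le> card (permutations_of_multiset M)"
      by (intro card_mono finite_permutations_of_multiset) (auto simp: permutations_of_multiset_def)
    also have "\<dots> \<le> fact (size M)"
      by (simp add: card_permutations_of_multiset)
    finally show "card {is \<in> tensor_index n d. mset is = M} \<le> fact d"
      using M by (simp add: index_msets_iff)
  qed
  finally show ?thesis by (simp add: mult.commute)
qed

lemma mset_coeff_diff: "mset_coeff n d M (S - T) = mset_coeff n d M S - mset_coeff n d M T"
  by (simp add: mset_coeff_def sum_subtractf)

lemma mset_coeff_add: "mset_coeff n d M (S + T) = mset_coeff n d M S + mset_coeff n d M T"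
  by (simp add: mset_coeff_def sum.distrib)

lemma mset_coeff_scale: "mset_coeff n d M (tensor_scale c T) = c * mset_coeff n d M T"
  by (simp add: mset_coeff_def tensor_scale_def sum_distrib_left)

lemma mset_coeff_permute:
  assumes \<sigma>: "\<sigma> permutes {..<d}"
  shows "mset_coeff n d M (permute_tensor \<sigma> T) = mset_coeff n d M T"
proof -
  have "bij_betw (permute_list \<sigma>) {is \<in> tensor_index n d. mset is = M} {is \<in> tensor_index n d. mset is = M}"
  proof (rule bij_betw_Collect[OF tensor_index_permute[OF \<sigma>]])
    show "mset (permute_list \<sigma> is) = M \<longleftrightarrow> mset is = M" if "is \<in> tensor_index n d" for "is"
      using that \<sigma> by (auto simp: tensor_index_def)
  qed
  then show ?thesis
    unfolding mset_coeff_def permute_tensor_def by (rule sum.reindex_bij_betw)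
qed

lemma mset_coeff_sym_relations:
  assumes "T \<in> sym_relations n d"
  shows "mset_coeff n d M T = 0"
  using assms unfolding sym_relations_def
proof (induction rule: tensor.span_induct_alt)
  case base
  show ?case by (simp add: mset_coeff_def)
next
  case (step c x y)
  then obtain T \<sigma> where x: "x = T - permute_tensor \<sigma> T" and \<sigma>: "\<sigma> permutes {..<d}" by auto
  have "mset_coeff n d M x = 0" by (simp add: x mset_coeff_diff mset_coeff_permute[OF \<sigma>])
  then show ?case unfolding mset_coeff_add mset_coeff_scale using step.IH by simp
qed

text \<open>
  The coefficients are the linear coordinates on the symmetric power: they vanish on
  \<^const>\<open>sym_relations\<close>, so that any representative of the class may be used.
\<close>

definition class_coeff :: "nat \<Rightarrow> nat \<Rightarrow> nat multiset \<Rightarrow> 'a::field tensor set \<Rightarrow> 'a"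
  where "class_coeff n d M f = mset_coeff n d M (SOME T. T \<in> f)"

lemma class_coeff_sym_class:
  assumes "T \<in> tensors n d"
  shows "class_coeff n d M (sym_class n d T) = mset_coeff n d M T"
proof -
  have "T \<in> sym_class n d T"
    using equiv_class_self[OF equiv_sym_equiv assms] by (simp add: sym_class_def)
  define S where "S = (SOME S. S \<in> sym_class n d T)"
  have "S \<in> sym_class n d T"
    unfolding S_def by (rule someI[where P = "\<lambda>S. S \<in> sym_class n d T"]) fact
  then have "T - S \<in> sym_relations n d"
    by (simp add: sym_class_def sym_equiv_def)
  from mset_coeff_sym_relations[OF this, of M] show ?thesis
    by (simp add: class_coeff_def mset_coeff_diff S_def[symmetric])
qed

lemma tensors_add: "S \<in> tensors n d \<Longrightarrow> T \<in> tensors n d \<Longrightarrow> S + T \<in> tensors n d"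
  for S T :: "'a::comm_ring_1 tensor"
  by (simp add: tensors_def)

lemma tensors_scale: "T \<in> tensors n d \<Longrightarrow> tensor_scale c T \<in> tensors n d"
  for T :: "'a::comm_ring_1 tensor"
  by (simp add: tensors_def tensor_scale_def)

lemma class_coeff_in_sym_poly_fun: "class_coeff n d M \<in> sym_poly_fun n d"
  by (rule sym_poly_fun.linear)
    (simp add: sym_linear_functional_def class_coeff_sym_class tensors_add tensors_scale
      mset_coeff_add mset_coeff_scale)

lemma sym_class_in_sym_power: "T \<in> tensors n d \<Longrightarrow> sym_class n d T \<in> sym_power n d"
  by (simp add: sym_class_def sym_power_def quotientI)

lemma sym_power_obtain:
  assumes "f \<in> sym_power n d"
  obtains T where "T \<in> tensors n d" "f = sym_class n d T"
  using assms unfolding sym_power_def sym_class_def by (auto elim: quotientE)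

lemma form_tensor_map:
  fixes A :: "'a::comm_ring_1 mat"
  assumes A: "A \<in> carrier_mat r n"
  shows "form r d (tensor_map d A T) y = form n d T (\<lambda>i. \<Sum>c<r. A $$ (c, i) * y c)"
proof -
  have dims: "dim_row A = r" "dim_col A = n" using A by auto
  have "form r d (tensor_map d A T) y = (\<Sum>js\<in>tensor_index r d. \<Sum>is\<in>tensor_index n d.
      T is * (\<Prod>k<d. A $$ (js ! k, is ! k) * y (js ! k)))"
    unfolding form_def
    by (intro sum.cong refl)
      (simp add: tensor_map_def dims sum_distrib_left sum_distrib_right prod.distrib mult_ac)
  also have "\<dots> = (\<Sum>is\<in>tensor_index n d. T is *
      (\<Sum>js\<in>tensor_index r d. \<Prod>k<d. A $$ (js ! k, is ! k) * y (js ! k)))"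
    by (subst sum.swap) (simp add: sum_distrib_left)
  also have "\<dots> = form n d T (\<lambda>i. \<Sum>c<r. A $$ (c, i) * y c)"
    unfolding form_def by (subst sum_prod_tensor_index) simp
  finally show ?thesis .
qed

lemma form_pure_power:
  assumes "i < r"
  shows "form r d (pure_tensor (replicate d (unit_vec r i))) y = (y i :: 'a::comm_ring_1) ^ d"
proof -
  have "pure_tensor (replicate d (unit_vec r i)) is * (\<Prod>k<d. y (is ! k))
      = (\<Prod>k<d. if is ! k = i then y (is ! k) else 0)" if "is \<in> tensor_index r d" for "is"
  proof -
    have len: "length is = d" and lt: "is ! k < r" if "k < d" for k
      using \<open>is \<in> tensor_index r d\<close> that by (auto simp: tensor_index_def subset_eq)
    have "length is = d" using that by (simp add: tensor_index_def)
    then have "pure_tensor (replicate d (unit_vec r i)) is = (\<Prod>k<d. if is ! k = i then 1 else (0::'a))"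
      using lt assms by (auto simp: pure_tensor_def list_all2_conv_all_nth intro!: prod.cong)
    then show ?thesis
      by (simp add: prod.distrib[symmetric] if_distrib[of "\<lambda>a. a * _"] cong: if_cong)
  qed
  then have "form r d (pure_tensor (replicate d (unit_vec r i))) y
      = (\<Sum>is\<in>tensor_index r d. \<Prod>k<d. if is ! k = i then y (is ! k) else 0)"
    unfolding form_def by (intro sum.cong) auto
  also have "\<dots> = (\<Prod>k<d. \<Sum>j<r. if j = i then y j else 0)"
    by (rule sum_prod_tensor_index)
  also have "\<dots> = y i ^ d" using assms by simp
  finally show ?thesis .
qed

definition power_sum_tensor :: "nat \<Rightarrow> nat \<Rightarrow> 'a::field tensor"
  where "power_sum_tensor r d = (\<Sum>i<r. pure_tensor (replicate d (unit_vec r i)))"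

lemma power_sum_tensor_in_tensors: "(power_sum_tensor r d :: 'a::field tensor) \<in> tensors r d"
proof -
  have "(\<Sum>i\<in>I. pure_tensor (replicate d (unit_vec r i))) \<in> (tensors r d :: 'a tensor set)" for I
  proof (induction I rule: infinite_finite_induct)
    case (insert i I)
    have "pure_tensor (replicate d (unit_vec r i)) \<in> (tensors r d :: 'a tensor set)"
      by (rule pure_tensor_in_tensors) auto
    from tensors_add[OF this insert.IH] show ?case
      unfolding sum.insert[OF insert.hyps] .
  qed (auto simp: tensors_def)
  then show ?thesis by (simp add: power_sum_tensor_def)
qed

lemma form_add: "form n d (S + T) x = form n d S x + form n d T x"
  by (simp add: form_def distrib_right sum.distrib)

lemma form_power_sum_tensor: "form r d (power_sum_tensor r d) y = (\<Sum>i<r. (y i :: 'a::field) ^ d)"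
proof -
  have "form r d (\<Sum>i\<in>I. pure_tensor (replicate d (unit_vec r i))) y = (\<Sum>i\<in>I. y i ^ d)"
    if "I \<subseteq> {..<r}" for I
    using finite_subset[OF that finite_lessThan] that
  proof (induction I rule: finite_induct)
    case empty
    show ?case by (simp add: form_def)
  next
    case (insert i I)
    then show ?case
      unfolding sum.insert[OF insert.hyps] form_add by (simp add: form_pure_power)
  qed
  then show ?thesis by (simp add: power_sum_tensor_def)
qed

lemma unit_sym_tensor_eq: "unit_sym_tensor r d = sym_class r d (power_sum_tensor r d)"
  by (simp add: unit_sym_tensor_def power_sum_tensor_def)

section \<open>Degenerations to power sums\<close>

lemma form_cong: "(\<And>i. i < n \<Longrightarrow> x i = y i) \<Longrightarrow> form n d T x = form n d T y"
  unfolding form_def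
  by (intro sum.cong arg_cong[of _ _ "\<lambda>a. _ * a"] prod.cong refl) (auto simp: tensor_index_def subset_eq)

lemma form_zero: "d > 0 \<Longrightarrow> form n d T (\<lambda>_. 0) = 0"
  by (simp add: form_def power_0_left)

text \<open>
  The vectors \<open>\<eta> c\<close> span a space of dimension \<open>card (C - J)\<close> on which the power sum vanishes. The
  coefficient of \<open>t\<^sup>a\<close> in \<open>\<Sum>\<^sub>b (t * \<eta> c b + \<eta> c' b)\<^sup>d = 0\<close> expresses the identity matrix of that size
  through a product that factors through a space of dimension \<open>card J\<close>.
\<close>

lemma isotropic_subspace_card:
  fixes \<eta> :: "'c \<Rightarrow> 'c \<Rightarrow> 'k::alg_closed_field"
  assumes C: "finite C" "J \<subseteq> C"
    and a: "0 < a" "a < d" "of_nat (d choose a) \<noteq> (0::'k)"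
    and unit: "\<And>c b. c \<in> C - J \<Longrightarrow> b \<in> C - J \<Longrightarrow> \<eta> c b = (if b = c then 1 else 0)"
    and isotropic: "\<And>c c' t. c \<in> C - J \<Longrightarrow> c' \<in> C - J \<Longrightarrow> (\<Sum>b\<in>C. (t * \<eta> c b + \<eta> c' b) ^ d) = 0"
  shows "card (C - J) \<le> card J"
proof (rule ccontr)
  assume "\<not> ?thesis"
  then have less: "card J < card (C - J)" by simp
  have J: "finite J" using C finite_subset by blast
  have polar: "(\<Sum>b\<in>J. \<eta> c b ^ a * \<eta> c' b ^ (d - a)) = - (if c = c' then 1 else 0)"
    if c: "c \<in> C - J" "c' \<in> C - J" for c c'
  proof -
    define p where "p = (\<Sum>b\<in>C. [:\<eta> c' b, \<eta> c b:] ^ d)"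
    have "poly p t = 0" for t
      using isotropic[OF c, of t] by (simp add: p_def poly_sum add.commute)
    then have "p = 0" by (rule poly_eq_0_if_vanishes)
    then have "0 = coeff p a" by simp
    also have "\<dots> = (\<Sum>b\<in>C. of_nat (d choose a) * (\<eta> c b ^ a * \<eta> c' b ^ (d - a)))"
      using a by (simp add: p_def coeff_sum coeff_linear_poly_power mult.assoc)
    finally have "0 = (\<Sum>b\<in>C. \<eta> c b ^ a * \<eta> c' b ^ (d - a))"
      using a(3) by (simp add: sum_distrib_left[symmetric])
    also have "\<dots> = (\<Sum>b\<in>C - J. \<eta> c b ^ a * \<eta> c' b ^ (d - a)) + (\<Sum>b\<in>J. \<eta> c b ^ a * \<eta> c' b ^ (d - a))"
      by (rule sum.subset_diff[OF C(2,1)])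
    also have "(\<Sum>b\<in>C - J. \<eta> c b ^ a * \<eta> c' b ^ (d - a)) = (\<Sum>b\<in>C - J. if b = c then (if c = c' then 1 else 0) else 0)"
      using a c by (intro sum.cong) (auto simp: unit)
    also have "\<dots> = (if c = c' then 1 else 0)"
      using c C by simp
    finally show ?thesis by (metis add.commute eq_neg_iff_add_eq_0)
  qed
  obtain x v where v: "v \<in> C - J" "x v \<noteq> 0"
    and x: "\<And>b. b \<in> J \<Longrightarrow> (\<Sum>c\<in>C - J. \<eta> c b ^ a * x c) = 0"
    using underdetermined_system[OF J _ less, of "\<lambda>b c. \<eta> c b ^ a"] C by auto
  have "x v = (\<Sum>c\<in>C - J. if c = v then x c else 0)"
    using v C by simp
  also have "\<dots> = (\<Sum>c\<in>C - J. - (x c * (\<Sum>b\<in>J. \<eta> c b ^ a * \<eta> v b ^ (d - a))))"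
    using v by (intro sum.cong) (auto simp: polar)
  also have "\<dots> = - (\<Sum>b\<in>J. (\<Sum>c\<in>C - J. \<eta> c b ^ a * x c) * \<eta> v b ^ (d - a))"
    unfolding sum_negf sum_distrib_left sum_distrib_right
    by (subst sum.swap) (simp add: mult_ac)
  also have "\<dots> = 0" by (simp add: x)
  finally show False using v by simp
qed

text \<open>
  Membership in the closure says precisely that \<open>P g\<close> depends only on the restriction of \<open>P\<close> to the
  set. The argument of the functions in the graph is the family of entries of the matrix.
\<close>

lemma closure_hom_graph:
  fixes f :: "'k::field tensor set"
  assumes g: "g \<in> zariski_closure r d {sym_map d A f | A. A \<in> carrier_mat r n}"
  shows "hom_graph {((\<lambda>x. P (sym_map d (mat r n x) f)), P g) | P. P \<in> sym_poly_fun r d}"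
    (is "hom_graph ?G")
proof
  show "(\<lambda>_. c, c) \<in> ?G" for c
    by (rule CollectI, rule exI[of _ "\<lambda>_. c"]) (simp add: sym_poly_fun.const)
  fix u v a b
  assume "(u, a) \<in> ?G" "(v, b) \<in> ?G"
  then obtain P Q where PQ: "P \<in> sym_poly_fun r d" "Q \<in> sym_poly_fun r d"
    "u = (\<lambda>x. P (sym_map d (mat r n x) f))" "a = P g"
    "v = (\<lambda>x. Q (sym_map d (mat r n x) f))" "b = Q g" by blast
  show "(u + v, a + b) \<in> ?G"
    by (rule CollectI, rule exI[of _ "\<lambda>f. P f + Q f"]) (use PQ in \<open>auto intro: sym_poly_fun.add\<close>)
  show "(u * v, a * b) \<in> ?G"
    by (rule CollectI, rule exI[of _ "\<lambda>f. P f * Q f"]) (use PQ in \<open>auto intro: sym_poly_fun.mult\<close>)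
next
  fix a
  assume "(0, a) \<in> ?G"
  then obtain P where P: "P \<in> sym_poly_fun r d" "(\<lambda>x. P (sym_map d (mat r n x) f)) = 0" "a = P g"
    by force
  have "P (sym_map d A f) = 0" if "A \<in> carrier_mat r n" for A
  proof -
    have "A = mat r n (\<lambda>p. A $$ p)" using that by (intro eq_matI) auto
    with fun_cong[OF P(2), of "\<lambda>p. A $$ p"] show ?thesis by simp
  qed
  then show "a = 0" using g P(1,3) unfolding zariski_closure_def by blast
qed

context place
begin

lemma form_in_graph:
  assumes "\<And>i. i < n \<Longrightarrow> (v i, \<omega> i) \<in> G"
  shows "((\<lambda>x. form n d T (\<lambda>i. v i x)), form n d T \<omega>) \<in> G"
proof -
  have "((\<Sum>is\<in>tensor_index n d. (\<lambda>_. T is) * (\<Prod>k<d. v (is ! k))), form n d T \<omega>) \<in> G"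
    unfolding form_def
    by (intro sum mult const prod) (auto simp: tensor_index_def subset_eq intro!: assms)
  also have "(\<Sum>is\<in>tensor_index n d. (\<lambda>_. T is) * (\<Prod>k<d. v (is ! k))) = (\<lambda>x. form n d T (\<lambda>i. v i x))"
    by (auto simp: form_def sum_fun_apply prod_fun_apply)
  finally show ?thesis .
qed

end

text \<open>
  The coefficients of \<open>F \<circ> A\<^sup>T\<close> have those of the power sum as values. Evaluation at \<open>y\<close> therefore
  yields the power sum at \<open>\<eta>\<close>, and evaluation of \<open>F\<close> at \<open>A\<^sup>T y\<close> yields \<open>F\<close> at \<open>\<omega>\<close>.
\<close>

lemma limit_pair_form:
  fixes G :: "(((nat \<times> nat \<Rightarrow> 'k) \<Rightarrow> 'k) \<times> 'k::field) set"
  assumes "place G" and d: "d > 0" and C: "C \<subseteq> {..<r}"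
    and coeffs: "\<And>M. ((\<lambda>x. mset_coeff r d M (tensor_map d (mat r n x) T)),
        mset_coeff r d M (power_sum_tensor r d)) \<in> G"
    and lim: "place.limit_pair G n C (\<lambda>c i x. x (c, i)) \<eta> \<omega>"
  shows "form n d T \<omega> = (\<Sum>c\<in>C. \<eta> c ^ d)"
proof -
  interpret place G by fact
  obtain y where y: "\<And>c. c \<in> C \<Longrightarrow> (y c, \<eta> c) \<in> G"
    and Ly: "\<And>i. i < n \<Longrightarrow> ((\<Sum>c\<in>C. y c * (\<lambda>x. x (c, i))), \<omega> i) \<in> G"
    using lim unfolding limit_pair_def by blast
  \<comment> \<open>Only the coordinates in \<open>C\<close> are used; this restricts the unit tensor to fewer variables.\<close>
  define y' \<eta>' where "y' c = (if c \<in> C then y c else 0)" and "\<eta>' c = (if c \<in> C then \<eta> c else 0)" for c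
  have y': "(y' c, \<eta>' c) \<in> G" for c
    using y zero_in by (simp add: y'_def \<eta>'_def)
  have "((\<Sum>M\<in>index_msets r d. (\<lambda>x. mset_coeff r d M (tensor_map d (mat r n x) T)) * (\<Prod>c\<in>#M. y' c)),
      (\<Sum>M\<in>index_msets r d. mset_coeff r d M (power_sum_tensor r d) * (\<Prod>c\<in>#M. \<eta>' c))) \<in> G"
    by (intro sum mult coeffs prod_mset y')
  also have "(\<Sum>M\<in>index_msets r d. (\<lambda>x. mset_coeff r d M (tensor_map d (mat r n x) T)) * (\<Prod>c\<in>#M. y' c))
      = (\<lambda>x. form r d (tensor_map d (mat r n x) T) (\<lambda>c. y' c x))"
    by (auto simp: form_eq_sum_monomials sum_fun_apply prod_mset_fun_apply)
  also have "\<dots> = (\<lambda>x. form n d T (\<lambda>i. (\<Sum>c\<in>C. y c * (\<lambda>x. x (c, i))) x))"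
  proof
    fix x :: "nat \<times> nat \<Rightarrow> 'k"
    have "form r d (tensor_map d (mat r n x) T) (\<lambda>c. y' c x)
        = form n d T (\<lambda>i. \<Sum>c<r. mat r n x $$ (c, i) * y' c x)"
      by (rule form_tensor_map) simp
    also have "\<dots> = form n d T (\<lambda>i. (\<Sum>c\<in>C. y c * (\<lambda>x. x (c, i))) x)"
    proof (rule form_cong)
      fix i assume i: "i < n"
      have "(\<Sum>c<r. mat r n x $$ (c, i) * y' c x) = (\<Sum>c\<in>C. mat r n x $$ (c, i) * y' c x)"
        using C by (intro sum.mono_neutral_right) (auto simp: y'_def)
      also have "\<dots> = (\<Sum>c\<in>C. y c x * x (c, i))"
        using C i by (intro sum.cong) (auto simp: y'_def subset_eq)
      finally show "(\<Sum>c<r. mat r n x $$ (c, i) * y' c x) = (\<Sum>c\<in>C. y c * (\<lambda>x. x (c, i))) x"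
        by (simp add: sum_fun_apply)
    qed
    finally show "form r d (tensor_map d (mat r n x) T) (\<lambda>c. y' c x)
        = form n d T (\<lambda>i. (\<Sum>c\<in>C. y c * (\<lambda>x. x (c, i))) x)" .
  qed
  also have "(\<Sum>M\<in>index_msets r d. mset_coeff r d M (power_sum_tensor r d) * (\<Prod>c\<in>#M. \<eta>' c)) = (\<Sum>c<r. \<eta>' c ^ d)"
    by (simp add: form_eq_sum_monomials[symmetric] form_power_sum_tensor)
  also have "\<dots> = (\<Sum>c\<in>C. \<eta> c ^ d)"
    using C d by (intro sum.mono_neutral_cong_right) (auto simp: \<eta>'_def power_0_left)
  finally show ?thesis
    using unique form_in_graph[where v = "\<lambda>i. \<Sum>c\<in>C. y c * (\<lambda>x. x (c, i))" and n = n and d = d and T = T, OF Ly]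
    by blast
qed

text \<open>
  The limit pairs with second component \<open>0\<close> span a subspace on which the power sum vanishes, so that
  at least half of the \<open>2 * m\<close> columns are pivots. The limit pairs of \<open>m\<close> pivots give the vectors \<open>w\<close>
  and the linear forms \<open>\<zeta>\<close>.
\<close>

theorem restricted_power_sum_if_degeneration:
  fixes T :: "'k::alg_closed_field tensor"
  assumes T: "T \<in> tensors n d" and d: "d > 0" and "\<And>k. d \<noteq> char_exponent TYPE('k) ^ k"
    and r: "2 * m \<le> r"
    and closure: "unit_sym_tensor r d
        \<in> zariski_closure r d {sym_map d A (sym_class n d T) | A. A \<in> carrier_mat r n}"
  shows "\<exists>\<rho> w \<zeta>. inj_on \<rho> {..<m} \<and> \<rho> ` {..<m} \<subseteq> {..<n} \<and>
      (\<forall>j<m. \<forall>k<m. w j (\<rho> k) = (if k = j then 1 else 0)) \<and>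
      (\<forall>z. form n d T (\<lambda>i. \<Sum>j<m. z j * w j i) = (\<Sum>c<2 * m. (\<Sum>j<m. z j * \<zeta> j c) ^ d))"
proof -
  obtain a where a: "0 < a" "a < d" "of_nat (d choose a) \<noteq> (0::'k)"
    using ex_binomial_neq_0[OF d] assms(3) by blast
  let ?f = "sym_class n d T"
  obtain G where "place G" and G: "{((\<lambda>x. P (sym_map d (mat r n x) ?f)), P (unit_sym_tensor r d)) | P.
      P \<in> sym_poly_fun r d} \<subseteq> G"
    using hom_graph_extends_to_place[OF closure_hom_graph[OF closure]] by blast
  interpret place G by fact
  have coeffs: "((\<lambda>x. mset_coeff r d M (tensor_map d (mat r n x) T)),
        mset_coeff r d M (power_sum_tensor r d)) \<in> G" for M
  proof -
    have "((\<lambda>x. class_coeff r d M (sym_map d (mat r n x) ?f)), class_coeff r d M (unit_sym_tensor r d)) \<in> G"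
      using G class_coeff_in_sym_poly_fun by blast
    moreover have "class_coeff r d M (sym_map d (mat r n x) ?f) = mset_coeff r d M (tensor_map d (mat r n x) T)" for x
      using tensor_map_in_tensors[of d "mat r n x" T]
      unfolding sym_map_class[OF mat_carrier T] by (simp add: class_coeff_sym_class)
    moreover have "class_coeff r d M (unit_sym_tensor r d) = mset_coeff r d M (power_sum_tensor r d :: 'k tensor)"
      by (simp add: unit_sym_tensor_eq class_coeff_sym_class power_sum_tensor_in_tensors)
    ultimately show ?thesis by simp
  qed
  define C where "C = {..<2 * m}"
  have C: "finite C" "C \<subseteq> {..<r}" using r by (auto simp: C_def)
  define L where "L = (\<lambda>c i (x :: nat \<times> nat \<Rightarrow> 'k). x (c, i))"
  have limit: "form n d T \<omega> = (\<Sum>c\<in>C. \<eta> c ^ d)" if "limit_pair n C L \<eta> \<omega>" for \<eta> \<omega>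
    using limit_pair_form[OF \<open>place G\<close> d C(2) coeffs] that by (simp add: L_def)
  from elimination[OF C(1), of n L]
  obtain J \<rho> \<beta> \<zeta> w where J: "J \<subseteq> C" and \<rho>: "inj_on \<rho> J" "\<rho> ` J \<subseteq> {..<n}"
    and free: "\<forall>c\<in>C - J. limit_pair n C L (\<lambda>c'. if c' \<in> J then \<beta> c c' else if c' = c then 1 else 0) (\<lambda>_. 0)"
    and piv: "\<forall>j\<in>J. limit_pair n C L (\<zeta> j) (w j) \<and> (\<forall>k\<in>J. w j (\<rho> k) = (if k = j then 1 else 0))"
    by (elim exE conjE)
  define \<eta> where "\<eta> c = (\<lambda>c'. if c' \<in> J then \<beta> c c' else if c' = c then 1 else 0)" for c
  have "card (C - J) \<le> card J"
  proof (rule isotropic_subspace_card[OF C(1) J a, of \<eta>])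
    fix c c' t
    assume c: "c \<in> C - J" "c' \<in> C - J"
    have "limit_pair n C L (\<lambda>b. t * \<eta> c b + \<eta> c' b) (\<lambda>i. t * 0 + 0)"
      unfolding \<eta>_def by (intro limit_pair_add limit_pair_scale bspec[OF free] c)
    from limit[OF this] show "(\<Sum>b\<in>C. (t * \<eta> c b + \<eta> c' b) ^ d) = 0"
      by (simp add: form_zero[OF d])
  qed (auto simp: \<eta>_def)
  moreover have "card C = card (C - J) + card J"
    using J C by (simp add: card_Diff_subset finite_subset card_mono)
  ultimately have "m \<le> card J" by (simp add: C_def)
  then obtain J0 where J0: "J0 \<subseteq> J" "card J0 = m" "finite J0"
    using J C obtain_subset_with_card_n by (metis finite_subset)
  obtain h where h: "bij_betw h {..<m} J0"
    using ex_bij_betw_nat_finite[OF J0(3)] J0(2) by (auto simp: atLeast0LessThan)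
  have hJ: "h j \<in> J" if "j < m" for j
    using h J0 that by (auto simp: bij_betw_def)
  have h_inj: "inj_on h {..<m}" using h by (simp add: bij_betw_def)
  show ?thesis
  proof (rule exI[of _ "\<rho> \<circ> h"], rule exI[of _ "\<lambda>j. w (h j)"], rule exI[of _ "\<lambda>j. \<zeta> (h j)"],
      intro conjI allI impI)
    show "inj_on (\<rho> \<circ> h) {..<m}"
      using h_inj \<rho>(1) hJ by (auto simp: inj_on_def)
    show "(\<rho> \<circ> h) ` {..<m} \<subseteq> {..<n}"
      using \<rho>(2) hJ by auto
    show "w (h j) ((\<rho> \<circ> h) k) = (if k = j then 1 else 0)" if "j < m" "k < m" for j k
      using piv hJ that h_inj by (auto simp: inj_on_def)
    fix z
    have "limit_pair n C L (\<lambda>c. \<Sum>j<m. z j * \<zeta> (h j) c) (\<lambda>i. \<Sum>j<m. z j * w (h j) i)"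
      using piv hJ by (intro limit_pair_sum) auto
    from limit[OF this]
    show "form n d T (\<lambda>i. \<Sum>j<m. z j * w (h j) i) = (\<Sum>c<2 * m. (\<Sum>j<m. z j * \<zeta> (h j) c) ^ d)"
      by (simp add: C_def)
  qed
qed

section \<open>Counting parameters\<close>

text \<open>
  Polynomial functions in the variables \<open>V\<close> whose degree in every single variable is at most \<open>e\<close>;
  with this notion of degree there are exactly \<open>(e + 1) ^ card V\<close> monomials.
\<close>

definition polyfun :: "'v set \<Rightarrow> nat \<Rightarrow> (('v \<Rightarrow> 'k::comm_ring_1) \<Rightarrow> 'k) set"
  where "polyfun V e =
    {f. \<exists>a. f = (\<lambda>p. \<Sum>h\<in>PiE V (\<lambda>_. {..e}). a h * (\<Prod>v\<in>V. p v ^ h v))}"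

lemma polyfunI:
  assumes "\<And>p. f p = (\<Sum>h\<in>PiE V (\<lambda>_. {..e}). a h * (\<Prod>v\<in>V. p v ^ h v))"
  shows "f \<in> polyfun V e"
  unfolding polyfun_def by (rule CollectI, rule exI[of _ a], rule ext, rule assms)

lemma polyfunD:
  assumes "f \<in> polyfun V e"
  shows "\<exists>a. \<forall>p. f p = (\<Sum>h\<in>PiE V (\<lambda>_. {..e}). a h * (\<Prod>v\<in>V. p v ^ h v))"
  using assms unfolding polyfun_def by auto

context
  fixes V :: "'v set"
  assumes V: "finite V"
begin

lemma finite_exponents: "finite (PiE V (\<lambda>_. {..e::nat}))"
  using V by (rule finite_PiE) simp

lemma polyfun_monomial:
  assumes "\<And>v. v \<in> V \<Longrightarrow> h v \<le> e"
  shows "(\<lambda>p. \<Prod>v\<in>V. p v ^ h v) \<in> polyfun V e"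
proof -
  let ?h = "restrict h V"
  have h: "?h \<in> PiE V (\<lambda>_. {..e})" using assms by auto
  have eq: "(\<Prod>v\<in>V. p v ^ h v) = (\<Sum>h'\<in>PiE V (\<lambda>_. {..e}). (if h' = ?h then 1 else 0) * (\<Prod>v\<in>V. p v ^ h' v))"
    for p :: "'v \<Rightarrow> 'k::comm_ring_1"
    using h finite_exponents by (simp add: if_distrib[of "\<lambda>a. a * _"] cong: if_cong)
  then show ?thesis by (rule polyfunI)
qed

lemma polyfun_add:
  assumes "f \<in> polyfun V e" "g \<in> polyfun V e"
  shows "(\<lambda>p. f p + g p) \<in> polyfun V e"
proof -
  obtain a b where "\<forall>p. f p = (\<Sum>h\<in>PiE V (\<lambda>_. {..e}). a h * (\<Prod>v\<in>V. p v ^ h v))"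
    "\<forall>p. g p = (\<Sum>h\<in>PiE V (\<lambda>_. {..e}). b h * (\<Prod>v\<in>V. p v ^ h v))"
    using assms[THEN polyfunD] by blast
  then show ?thesis
    by (intro polyfunI[where a = "\<lambda>h. a h + b h"]) (simp add: distrib_right sum.distrib)
qed

lemma polyfun_scale:
  assumes "f \<in> polyfun V e"
  shows "(\<lambda>p. c * f p) \<in> polyfun V e"
proof -
  obtain a where "\<forall>p. f p = (\<Sum>h\<in>PiE V (\<lambda>_. {..e}). a h * (\<Prod>v\<in>V. p v ^ h v))"
    using polyfunD[OF assms] by blast
  then show ?thesis
    by (intro polyfunI[where a = "\<lambda>h. c * a h"]) (simp add: sum_distrib_left mult.assoc)
qed

lemma polyfun_zero: "(\<lambda>p. 0) \<in> polyfun V e"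
  using polyfun_scale[OF polyfun_monomial[of "\<lambda>_. 0" e], of 0] by simp

lemma polyfun_one: "(\<lambda>p. 1) \<in> polyfun V e"
  using polyfun_monomial[of "\<lambda>_. 0" e] by simp

lemma polyfun_sum:
  assumes "\<And>s. s \<in> S \<Longrightarrow> f s \<in> polyfun V e"
  shows "(\<lambda>p. \<Sum>s\<in>S. f s p) \<in> polyfun V e"
  using assms
  by (induction S rule: infinite_finite_induct) (auto intro: polyfun_zero polyfun_add)

lemma polyfun_diff:
  assumes "f \<in> polyfun V e" "g \<in> polyfun V e"
  shows "(\<lambda>p. f p - g p) \<in> polyfun V e"
  using polyfun_add[OF assms(1) polyfun_scale[OF assms(2), of "- 1"]] by simp

lemma polyfun_mult:
  assumes "f \<in> polyfun V e" "g \<in> polyfun V e'"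
  shows "(\<lambda>p. f p * g p) \<in> polyfun V (e + e')"
proof -
  obtain a where f: "\<And>p. f p = (\<Sum>h\<in>PiE V (\<lambda>_. {..e}). a h * (\<Prod>v\<in>V. p v ^ h v))"
    using polyfunD[OF assms(1)] by blast
  obtain b where g: "\<And>p. g p = (\<Sum>h\<in>PiE V (\<lambda>_. {..e'}). b h * (\<Prod>v\<in>V. p v ^ h v))"
    using polyfunD[OF assms(2)] by blast
  have "(\<lambda>p. f p * g p) = (\<lambda>p. \<Sum>h\<in>PiE V (\<lambda>_. {..e}). \<Sum>h'\<in>PiE V (\<lambda>_. {..e'}).
      (a h * b h') * (\<Prod>v\<in>V. p v ^ (h v + h' v)))"
    unfolding f g by (simp add: sum_product power_add prod.distrib mult_ac)
  also have "\<dots> \<in> polyfun V (e + e')"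
    by (intro polyfun_sum polyfun_scale polyfun_monomial add_mono) auto
  finally show ?thesis .
qed

lemma polyfun_mono:
  assumes "f \<in> polyfun V e" "e \<le> e'"
  shows "f \<in> polyfun V e'"
proof -
  obtain a where f: "f = (\<lambda>p. \<Sum>h\<in>PiE V (\<lambda>_. {..e}). a h * (\<Prod>v\<in>V. p v ^ h v))"
    using polyfunD[OF assms(1)] by (auto simp: fun_eq_iff)
  have "h v \<le> e'" if "h \<in> PiE V (\<lambda>_. {..e})" "v \<in> V" for h v
    using that assms(2) by (auto simp: PiE_iff intro: order_trans)
  then show ?thesis unfolding f
    by (intro polyfun_sum polyfun_scale polyfun_monomial) auto
qed

lemma polyfun_var: "v \<in> V \<Longrightarrow> (\<lambda>p :: 'v \<Rightarrow> 'k::comm_ring_1. p v) \<in> polyfun V 1"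
proof -
  assume v: "v \<in> V"
  have "(\<Prod>u\<in>V. p u ^ (if u = v then 1 else 0)) = p v" for p :: "'v \<Rightarrow> 'k::comm_ring_1"
    using v V prod.delta[OF V, of v p] by (simp add: if_distrib[of "power _"] cong: if_cong)
  moreover have "(\<lambda>p. \<Prod>u\<in>V. p u ^ (if u = v then 1 else 0)) \<in> (polyfun V 1 :: (('v \<Rightarrow> 'k) \<Rightarrow> 'k) set)"
    by (rule polyfun_monomial) simp
  ultimately show ?thesis by simp
qed

lemma polyfun_prod:
  assumes "\<And>s. s \<in> S \<Longrightarrow> f s \<in> polyfun V (e s)"
  shows "(\<lambda>p. \<Prod>s\<in>S. f s p) \<in> polyfun V (\<Sum>s\<in>S. e s)"
  using assms
  by (induction S rule: infinite_finite_induct) (auto intro: polyfun_one polyfun_mult)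

lemma polyfun_power: "f \<in> polyfun V e \<Longrightarrow> (\<lambda>p. f p ^ n) \<in> polyfun V (n * e)"
  by (induction n) (auto intro: polyfun_one polyfun_mult)

text \<open>
  There are \<open>(D + 1) ^ card I\<close> monomials in the \<open>\<Phi> i\<close> with exponents up to \<open>D\<close>, and they lie in a space
  whose dimension grows only like \<open>D ^ card V\<close>.
\<close>

lemma algebraic_dependence:
  fixes \<Phi> :: "'i \<Rightarrow> ('v \<Rightarrow> 'k::field) \<Rightarrow> 'k"
  assumes I: "finite I" and card: "card V < card I"
    and \<Phi>: "\<And>i. i \<in> I \<Longrightarrow> \<Phi> i \<in> polyfun V e"
  shows "\<exists>D a. (\<exists>g\<in>PiE I (\<lambda>_. {..D}). a g \<noteq> 0) \<and>
    (\<forall>p. (\<Sum>g\<in>PiE I (\<lambda>_. {..D::nat}). a g * (\<Prod>i\<in>I. \<Phi> i p ^ g i)) = 0)"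
proof -
  define N M where "N = card I" and "M = card V"
  \<comment> \<open>A choice for which the number of monomials exceeds the dimension, since
      \<open>e * N * D + 1 \<le> (e * N + 1) * (D + 1)\<close>.\<close>
  define D where "D = (e * N + 1) ^ M"
  define E where "E = e * N * D"
  let ?I = "PiE I (\<lambda>_. {..D})" and ?V = "PiE V (\<lambda>_. {..E})"
  have mem: "(\<lambda>p. \<Prod>i\<in>I. \<Phi> i p ^ g i) \<in> polyfun V E" if g: "g \<in> ?I" for g
  proof (rule polyfun_mono)
    show "(\<lambda>p. \<Prod>i\<in>I. \<Phi> i p ^ g i) \<in> polyfun V (\<Sum>i\<in>I. g i * e)"
      by (intro polyfun_prod polyfun_power \<Phi>)
    have "(\<Sum>i\<in>I. g i * e) \<le> (\<Sum>i\<in>I. D * e)"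
      using g by (intro sum_mono mult_right_mono) auto
    then show "(\<Sum>i\<in>I. g i * e) \<le> E" by (simp add: E_def N_def mult_ac)
  qed
  have "\<forall>g\<in>?I. \<exists>b. \<forall>p. (\<Prod>i\<in>I. \<Phi> i p ^ g i) = (\<Sum>h\<in>?V. b h * (\<Prod>v\<in>V. p v ^ h v))"
    using polyfunD[OF mem] by auto
  from bchoice[OF this] obtain b
    where b: "\<forall>g\<in>?I. \<forall>p. (\<Prod>i\<in>I. \<Phi> i p ^ g i) = (\<Sum>h\<in>?V. b g h * (\<Prod>v\<in>V. p v ^ h v))"
    by (elim exE)
  have "(E + 1) ^ M \<le> ((e * N + 1) * (D + 1)) ^ M"
    by (intro power_mono) (auto simp: E_def)
  also have "\<dots> = D * (D + 1) ^ M" by (simp only: power_mult_distrib D_def[symmetric])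
  also have "\<dots> < (D + 1) ^ Suc M" by simp
  also have "\<dots> \<le> (D + 1) ^ N" using card by (intro power_increasing) (auto simp: N_def M_def)
  finally have "card ?V < card ?I"
    using I V by (simp add: card_PiE M_def N_def)
  moreover have "finite ?I" using I by (intro finite_PiE) auto
  ultimately obtain x where x: "\<exists>g\<in>?I. x g \<noteq> 0" "\<And>h. h \<in> ?V \<Longrightarrow> (\<Sum>g\<in>?I. b g h * x g) = 0"
    using underdetermined_system[OF finite_exponents, of ?I E "\<lambda>h g. b g h"] by blast
  have "(\<Sum>g\<in>?I. x g * (\<Prod>i\<in>I. \<Phi> i p ^ g i)) = 0" for p
  proof -
    have "(\<Sum>g\<in>?I. x g * (\<Prod>i\<in>I. \<Phi> i p ^ g i)) = (\<Sum>g\<in>?I. \<Sum>h\<in>?V. b g h * x g * (\<Prod>v\<in>V. p v ^ h v))"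
      by (intro sum.cong refl) (simp add: b sum_distrib_left mult_ac)
    also have "\<dots> = (\<Sum>h\<in>?V. (\<Sum>g\<in>?I. b g h * x g) * (\<Prod>v\<in>V. p v ^ h v))"
      by (subst sum.swap) (simp add: sum_distrib_right)
    finally show ?thesis by (simp add: x(2))
  qed
  with x(1) show ?thesis by blast
qed

end

lemma prod_linear_forms:
  fixes z :: "nat \<Rightarrow> 'k::comm_ring_1"
  shows "(\<Prod>k<d. \<Sum>j<m. z j * v k j) = form m d (\<lambda>js. \<Prod>k<d. v k (js ! k)) z"
  unfolding form_def by (subst sum_prod_tensor_index[symmetric]) (simp add: prod.distrib mult.commute)

lemma sum_form: "(\<Sum>s\<in>S. a s * form m d (F s) z)
    = (\<Sum>M\<in>index_msets m d. (\<Sum>s\<in>S. a s * mset_coeff m d M (F s)) * (\<Prod>i\<in>#M. z i))"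
  unfolding form_eq_sum_monomials sum_distrib_left sum_distrib_right
  by (subst sum.swap) (simp add: mult.assoc)

text \<open>
  Comparison of the coefficients of \<open>z\<^sup>M\<close> in the two expressions for the restricted form. The list
  \<open>l N\<close> is an arbitrary arrangement of \<open>N\<close>.
\<close>

lemma restricted_coefficients:
  fixes T :: "'k::alg_closed_field tensor"
  assumes l: "\<And>N. N \<in> index_msets n d \<Longrightarrow> mset (l N) = N"
    and eq: "\<And>z. form n d T (\<lambda>i. \<Sum>j<m. z j * w j i) = (\<Sum>c<s. (\<Sum>j<m. z j * \<zeta> j c) ^ d)"
    and M: "M \<in> index_msets m d"
  shows "(\<Sum>N\<in>index_msets n d. mset_coeff n d N T * mset_coeff m d M (\<lambda>js. \<Prod>k<d. w (js ! k) (l N ! k)))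
    = (\<Sum>c<s. mset_coeff m d M (\<lambda>js. \<Prod>k<d. \<zeta> (js ! k) c))"
proof -
  let ?lhs = "\<lambda>M. \<Sum>N\<in>index_msets n d. mset_coeff n d N T * mset_coeff m d M (\<lambda>js. \<Prod>k<d. w (js ! k) (l N ! k))"
  let ?rhs = "\<lambda>M. \<Sum>c<s. mset_coeff m d M (\<lambda>js. \<Prod>k<d. \<zeta> (js ! k) c)"
  have "?lhs M - ?rhs M = 0"
  proof (rule multiset_monomials_independent[OF finite_index_msets _ M, where a = "\<lambda>M. ?lhs M - ?rhs M"])
    fix z
    have "(\<Sum>M\<in>index_msets m d. ?lhs M * (\<Prod>i\<in>#M. z i))
        = (\<Sum>N\<in>index_msets n d. mset_coeff n d N T * form m d (\<lambda>js. \<Prod>k<d. w (js ! k) (l N ! k)) z)"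
      by (rule sum_form[symmetric])
    also have "\<dots> = form n d T (\<lambda>i. \<Sum>j<m. z j * w j i)"
      unfolding form_eq_sum_monomials[of n]
    proof (intro sum.cong refl arg_cong[of _ _ "\<lambda>a. _ * a"])
      fix N assume N: "N \<in> index_msets n d"
      then have "length (l N) = d" using l by (metis index_msets_iff size_mset)
      then show "form m d (\<lambda>js. \<Prod>k<d. w (js ! k) (l N ! k)) z = (\<Prod>i\<in>#N. \<Sum>j<m. z j * w j i)"
        using prod_nth_eq_prod_mset[of "\<lambda>i. \<Sum>j<m. z j * w j i" "l N"] l[OF N]
        by (simp add: prod_linear_forms[where v = "\<lambda>k j. w j (l N ! k)", symmetric])
    qed
    also have "\<dots> = (\<Sum>c<s. 1 * form m d (\<lambda>js. \<Prod>k<d. \<zeta> (js ! k) c) z)"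
      unfolding eq
    proof (rule sum.cong[OF refl])
      fix c
      show "(\<Sum>j<m. z j * \<zeta> j c) ^ d = 1 * form m d (\<lambda>js. \<Prod>k<d. \<zeta> (js ! k) c) z"
        by (simp add: prod_linear_forms[where v = "\<lambda>k j. \<zeta> j c", symmetric])
    qed
    also have "\<dots> = (\<Sum>M\<in>index_msets m d. ?rhs M * (\<Prod>i\<in>#M. z i))"
      unfolding sum_form by simp
    finally show "(\<Sum>M\<in>index_msets m d. (?lhs M - ?rhs M) * (\<Prod>i\<in>#M. z i)) = 0"
      by (simp add: left_diff_distrib sum_subtractf)
  qed
  then show ?thesis by simp
qed

text \<open>
  In the pivot coordinates the restriction is the identity, so a monomial in these coordinates
  contributes to exactly one coefficient of the restricted form.
\<close>

lemma coordinate_coefficient: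
  fixes w :: "nat \<Rightarrow> nat \<Rightarrow> 'k::comm_ring_1"
  assumes \<rho>: "inj_on \<rho> {..<m}" and w: "\<And>j k. j < m \<Longrightarrow> k < m \<Longrightarrow> w j (\<rho> k) = (if k = j then 1 else 0)"
    and N: "N \<in> index_msets m d" and l: "mset l = image_mset \<rho> N"
  shows "mset_coeff m d M (\<lambda>js. \<Prod>k<d. w (js ! k) (l ! k)) = (if M = N then 1 else 0)"
proof -
  define \<sigma> where "\<sigma> = map (the_inv_into {..<m} \<rho>) l"
  have N': "size N = d" "set_mset N \<subseteq> {..<m}" using N by (auto simp: index_msets_iff)
  have "mset \<sigma> = image_mset (\<lambda>i. the_inv_into {..<m} \<rho> (\<rho> i)) N"
    by (simp add: \<sigma>_def l multiset.map_comp comp_def)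
  also have "\<dots> = image_mset (\<lambda>i. i) N"
    using N' by (intro image_mset_cong) (auto simp: the_inv_into_f_f[OF \<rho>])
  finally have \<sigma>: "mset \<sigma> = N" by simp
  have len: "length \<sigma> = d" using \<sigma> N' by (metis size_mset)
  have \<sigma>_in: "\<sigma> \<in> tensor_index m d"
    using len \<sigma> N' by (auto simp: tensor_index_def simp flip: set_mset_mset)
  have l_nth: "l ! k = \<rho> (\<sigma> ! k)" "\<sigma> ! k < m" if "k < d" for k
  proof -
    have "length l = d" using len by (simp add: \<sigma>_def)
    then have "l ! k \<in> set l" using that by simp
    also have "set l = \<rho> ` set_mset N" by (metis l set_image_mset set_mset_mset)
    finally have "l ! k \<in> \<rho> ` {..<m}" using N' by auto
    then show "l ! k = \<rho> (\<sigma> ! k)"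
      using \<open>length l = d\<close> that by (simp add: \<sigma>_def f_the_inv_into_f[OF \<rho>])
    show "\<sigma> ! k < m" using \<sigma>_in that by (auto simp: tensor_index_def subset_eq)
  qed
  have "(\<Prod>k<d. w (js ! k) (l ! k)) = (if js = \<sigma> then 1 else 0)" if js: "js \<in> tensor_index m d" for js
  proof -
    have js': "length js = d" "\<And>k. k < d \<Longrightarrow> js ! k < m" using js by (auto simp: tensor_index_def subset_eq)
    have "(\<Prod>k<d. w (js ! k) (l ! k)) = (\<Prod>k<d. if \<sigma> ! k = js ! k then 1 else 0)"
      using l_nth js' by (intro prod.cong refl) (simp add: w)
    also have "\<dots> = (if js = \<sigma> then 1 else 0)"
    proof (cases "js = \<sigma>")
      case False
      then obtain k where "k < d" "\<sigma> ! k \<noteq> js ! k" using len js'(1) by (metis nth_equalityI)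
      then have "(\<Prod>k<d. if \<sigma> ! k = js ! k then 1 else (0::'k)) = 0"
        by (intro prod_zero) auto
      then show ?thesis using False by simp
    qed simp
    finally show ?thesis .
  qed
  then have "mset_coeff m d M (\<lambda>js. \<Prod>k<d. w (js ! k) (l ! k))
      = (\<Sum>js\<in>{js \<in> tensor_index m d. mset js = M}. if js = \<sigma> then 1 else 0)"
    unfolding mset_coeff_def by (intro sum.cong) auto
  also have "\<dots> = (if M = N then 1 else 0)"
    using \<sigma> \<sigma>_in finite_tensor_index[of m d] by (auto simp: sum.delta)
  finally show ?thesis .
qed

text \<open>
  Let \<open>J\<close> be the set of monomials in the pivot coordinates. By \<open>restricted_coefficients\<close> and
  \<open>coordinate_coefficient\<close>, the coefficients of \<open>T\<close> at \<open>J\<close> are polynomials in \<open>w\<close>, \<open>\<zeta>\<close> and the other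
  coefficients. Altogether these are fewer parameters than coefficients, so the coefficients of \<open>T\<close>
  satisfy a fixed algebraic relation.
\<close>

theorem restricted_power_sums_hypersurface:
  assumes \<rho>: "inj_on \<rho> {..<m}" "\<rho> ` {..<m} \<subseteq> {..<n}"
    and card: "m * n + m * s < card (index_msets m d)"
  shows "\<exists>D a. (\<exists>g\<in>PiE (index_msets n d) (\<lambda>_. {..D}). a g \<noteq> (0::'k::alg_closed_field)) \<and>
    (\<forall>T w \<zeta>. (\<forall>j<m. \<forall>k<m. w j (\<rho> k) = (if k = j then 1 else 0)) \<longrightarrow>
      (\<forall>z. form n d T (\<lambda>i. \<Sum>j<m. z j * w j i) = (\<Sum>c<s. (\<Sum>j<m. z j * \<zeta> j c) ^ d)) \<longrightarrow>
      (\<Sum>g\<in>PiE (index_msets n d) (\<lambda>_. {..D::nat}). a g * (\<Prod>M\<in>index_msets n d. mset_coeff n d M T ^ g M)) = 0)"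
proof -
  define I where "I = index_msets n d"
  define J where "J = image_mset \<rho> ` index_msets m d"
  have I: "finite I" by (simp add: I_def finite_index_msets)
  have "\<rho> i < n" if "i < m" for i using \<rho>(2) that by auto
  then have "J \<subseteq> I" by (auto simp: J_def I_def index_msets_iff subset_eq)
  have inj: "inj_on (image_mset \<rho>) (index_msets m d)"
  proof (rule inj_on_inverseI)
    fix M assume "M \<in> index_msets m d"
    then have "image_mset (\<lambda>i. the_inv_into {..<m} \<rho> (\<rho> i)) M = image_mset (\<lambda>i. i) M"
      by (intro image_mset_cong) (auto simp: index_msets_iff the_inv_into_f_f[OF \<rho>(1)])
    then show "image_mset (the_inv_into {..<m} \<rho>) (image_mset \<rho> M) = M"
      by (simp add: multiset.map_comp comp_def)
  qed
  define r where "r = the_inv_into (index_msets m d) (image_mset \<rho>)"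
  have r: "r (image_mset \<rho> M) = M" if "M \<in> index_msets m d" for M
    using that by (simp add: r_def the_inv_into_f_f[OF inj])
  define l where "l N = (SOME xs. mset xs = N)" for N :: "nat multiset"
  have l: "mset (l N) = N" for N
    unfolding l_def by (rule someI_ex) (rule ex_mset)
  define V where "V = ({..<m} \<times> {..<n}) <+> (({..<m} \<times> {..<s}) <+> (I - J))"
  have V: "finite V" using I by (simp add: V_def)
  have "card J = card (index_msets m d)" unfolding J_def by (rule card_image[OF inj])
  moreover have "card J \<le> card I" using I \<open>J \<subseteq> I\<close> by (rule card_mono)
  ultimately have "card V < card I"
    using card I \<open>J \<subseteq> I\<close> by (simp add: V_def card_Plus card_Diff_subset finite_subset)
  \<comment> \<open>The coefficient at \<open>N\<close> as a function of the parameters: the left summand of the sum type carries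
      \<open>w\<close>, the middle one \<open>\<zeta>\<close>, and the right one the coefficients outside \<open>J\<close>.\<close>
  define \<Phi> :: "nat multiset \<Rightarrow> (nat \<times> nat + nat \<times> nat + nat multiset \<Rightarrow> 'k) \<Rightarrow> 'k"
    where "\<Phi> N p = (if N \<in> J
      then (\<Sum>c<s. mset_coeff m d (r N) (\<lambda>js. \<Prod>k<d. p (Inr (Inl (js ! k, c)))))
        - (\<Sum>N'\<in>I - J. p (Inr (Inr N')) * mset_coeff m d (r N) (\<lambda>js. \<Prod>k<d. p (Inl (js ! k, l N' ! k))))
      else p (Inr (Inr N)))" for N p
  have \<Phi>_poly: "\<Phi> N \<in> polyfun V (1 + d)" if N: "N \<in> I" for N
  proof (cases "N \<in> J")
    case True
    have prod: "(\<lambda>p :: _ \<Rightarrow> 'k. \<Prod>k<d. p (u k)) \<in> polyfun V d" if u: "\<And>k. k < d \<Longrightarrow> u k \<in> V"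
      for u :: "nat \<Rightarrow> nat \<times> nat + nat \<times> nat + nat multiset"
    proof -
      have "(\<lambda>p :: _ \<Rightarrow> 'k. \<Prod>k<d. p (u k)) \<in> polyfun V (\<Sum>k<d. 1)"
        by (intro polyfun_prod[OF V] polyfun_var[OF V] u) simp
      then show ?thesis by simp
    qed
    have ln: "l N' ! k < n" if "N' \<in> I - J" "k < d" for N' k
    proof -
      have N': "size N' = d" "set_mset N' \<subseteq> {..<n}" using that(1) by (auto simp: I_def index_msets_iff)
      then have "length (l N') = d" using l by (metis size_mset)
      then have "l N' ! k \<in> set_mset N'" using l that(2) by (metis nth_mem set_mset_mset)
      with N' show ?thesis by auto
    qed
    have jm: "js ! k < m" if "js \<in> tensor_index m d" "k < d" for js k
      using that by (auto simp: tensor_index_def subset_eq)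
    have "(\<lambda>p :: _ \<Rightarrow> 'k. \<Sum>c<s. mset_coeff m d (r N) (\<lambda>js. \<Prod>k<d. p (Inr (Inl (js ! k, c))))) \<in> polyfun V (1 + d)"
      unfolding mset_coeff_def
      by (rule polyfun_mono[OF V, of _ d], intro polyfun_sum[OF V] prod)
        (auto simp: V_def jm)
    moreover have "(\<lambda>p :: _ \<Rightarrow> 'k. \<Sum>N'\<in>I - J. p (Inr (Inr N')) * mset_coeff m d (r N) (\<lambda>js. \<Prod>k<d. p (Inl (js ! k, l N' ! k))))
        \<in> polyfun V (1 + d)"
      unfolding mset_coeff_def
      by (intro polyfun_sum[OF V] polyfun_mult[OF V] polyfun_var[OF V] prod)
        (auto simp: V_def jm ln)
    ultimately show ?thesis
      using polyfun_diff[OF V] True unfolding \<Phi>_def by simp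
  next
    case False
    then have "(\<lambda>p. p (Inr (Inr N)) :: 'k) \<in> polyfun V 1"
      using N by (intro polyfun_var[OF V]) (auto simp: V_def)
    then show ?thesis using False polyfun_mono[OF V, of _ 1 "1 + d"] unfolding \<Phi>_def by simp
  qed
  from algebraic_dependence[where \<Phi> = \<Phi>, OF V I \<open>card V < card I\<close> \<Phi>_poly]
  obtain D a where a: "\<exists>g\<in>PiE I (\<lambda>_. {..D}). a g \<noteq> 0"
    and zero: "\<And>p. (\<Sum>g\<in>PiE I (\<lambda>_. {..D::nat}). a g * (\<Prod>i\<in>I. \<Phi> i p ^ g i)) = 0" by blast
  have "(\<Sum>g\<in>PiE I (\<lambda>_. {..D}). a g * (\<Prod>M\<in>I. mset_coeff n d M T ^ g M)) = 0"
    if w: "\<forall>j<m. \<forall>k<m. w j (\<rho> k) = (if k = j then 1 else 0)"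
      and eq: "\<forall>z. form n d T (\<lambda>i. \<Sum>j<m. z j * w j i) = (\<Sum>c<s. (\<Sum>j<m. z j * \<zeta> j c) ^ d)"
    for T and w \<zeta> :: "nat \<Rightarrow> nat \<Rightarrow> 'k"
  proof -
    define p :: "nat \<times> nat + nat \<times> nat + nat multiset \<Rightarrow> 'k" where
      "p = case_sum (\<lambda>(j, i). w j i) (case_sum (\<lambda>(j, c). \<zeta> j c) (\<lambda>N. mset_coeff n d N T))"
    have "\<Phi> N p = mset_coeff n d N T" if N: "N \<in> I" for N
    proof (cases "N \<in> J")
      case True
      then obtain M where M: "M \<in> index_msets m d" "N = image_mset \<rho> M" by (auto simp: J_def)
      let ?S = "\<lambda>N'. mset_coeff m d M (\<lambda>js. \<Prod>k<d. w (js ! k) (l N' ! k))"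
      have S: "?S N' = (if N' = N then 1 else 0)" if N': "N' \<in> J" for N'
      proof -
        obtain M' where M': "M' \<in> index_msets m d" "N' = image_mset \<rho> M'" using N' by (auto simp: J_def)
        have "?S N' = (if M = M' then 1 else 0)"
          by (rule coordinate_coefficient[OF \<rho>(1) _ M'(1)]) (use w l M' in auto)
        then show ?thesis using M M' inj_on_eq_iff[OF inj M'(1) M(1)] by auto
      qed
      have "(\<Sum>c<s. mset_coeff m d M (\<lambda>js. \<Prod>k<d. \<zeta> (js ! k) c)) = (\<Sum>N'\<in>I. mset_coeff n d N' T * ?S N')"
        unfolding I_def using eq by (intro restricted_coefficients[symmetric] M(1) l) auto
      also have "\<dots> = (\<Sum>N'\<in>I - J. mset_coeff n d N' T * ?S N') + (\<Sum>N'\<in>J. mset_coeff n d N' T * ?S N')"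
        by (rule sum.subset_diff[OF \<open>J \<subseteq> I\<close> I])
      also have "(\<Sum>N'\<in>J. mset_coeff n d N' T * ?S N') = (\<Sum>N'\<in>J. if N' = N then mset_coeff n d N T else 0)"
        by (intro sum.cong) (auto simp: S)
      also have "\<dots> = mset_coeff n d N T"
        using True finite_subset[OF \<open>J \<subseteq> I\<close> I] by simp
      finally show ?thesis
        using True r[OF M(1)] M(2) by (simp add: \<Phi>_def p_def)
    next
      case False
      then show ?thesis by (simp add: \<Phi>_def p_def)
    qed
    then show ?thesis using zero[of p] by simp
  qed
  with a show ?thesis unfolding I_def by blast
qed

section \<open>The generic border subrank\<close>

lemma sym_poly_fun_sum:
  "(\<And>s. s \<in> S \<Longrightarrow> P s \<in> sym_poly_fun n d) \<Longrightarrow> (\<lambda>f. \<Sum>s\<in>S. P s f) \<in> sym_poly_fun n d"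
  by (induction S rule: infinite_finite_induct) (auto intro: sym_poly_fun.intros)

lemma sym_poly_fun_prod:
  "(\<And>s. s \<in> S \<Longrightarrow> P s \<in> sym_poly_fun n d) \<Longrightarrow> (\<lambda>f. \<Prod>s\<in>S. P s f) \<in> sym_poly_fun n d"
  by (induction S rule: infinite_finite_induct) (auto intro: sym_poly_fun.intros)

lemma sym_poly_fun_power: "P \<in> sym_poly_fun n d \<Longrightarrow> (\<lambda>f. P f ^ k) \<in> sym_poly_fun n d"
  by (induction k) (auto intro: sym_poly_fun.intros)

lemma sym_poly_fun_on_line:
  assumes "P \<in> sym_poly_fun n d" and S: "S \<in> tensors n d" and T: "T \<in> tensors n d"
  shows "\<exists>p. \<forall>t. P (sym_class n d (S + tensor_scale t T)) = poly p t"
  using assms(1)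
proof induction
  case (const c)
  show ?case by (intro exI[of _ "[:c:]"]) simp
next
  case (linear l)
  then have "l (sym_class n d (S + tensor_scale t T)) = poly [:l (sym_class n d S), l (sym_class n d T):] t" for t
    using S T by (simp add: sym_linear_functional_def tensors_scale)
  then show ?case by blast
next
  case (add P Q)
  then obtain p q where "\<forall>t. P (sym_class n d (S + tensor_scale t T)) = poly p t"
    "\<forall>t. Q (sym_class n d (S + tensor_scale t T)) = poly q t" by blast
  then show ?case by (intro exI[of _ "p + q"]) (simp only: poly_add simp_thms)
next
  case (mult P Q)
  then obtain p q where "\<forall>t. P (sym_class n d (S + tensor_scale t T)) = poly p t"
    "\<forall>t. Q (sym_class n d (S + tensor_scale t T)) = poly q t" by blast
  then show ?case by (intro exI[of _ "p * q"]) (simp only: poly_mult simp_thms)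
qed

text \<open>
  Restrict both functions to the line through \<open>f\<close> and \<open>g\<close>, where they become nonzero polynomials in one
  variable.
\<close>

lemma sym_power_irreducible:
  fixes P Q :: "'k::alg_closed_field tensor set \<Rightarrow> 'k"
  assumes P: "P \<in> sym_poly_fun n d" "f \<in> sym_power n d" "P f \<noteq> 0"
    and Q: "Q \<in> sym_poly_fun n d" "g \<in> sym_power n d" "Q g \<noteq> 0"
  shows "\<exists>h\<in>sym_power n d. P h * Q h \<noteq> 0"
proof -
  obtain S T where S: "S \<in> tensors n d" "f = sym_class n d S"
    and T: "T \<in> tensors n d" "g = sym_class n d T"
    using P(2) Q(2) by (meson sym_power_obtain)
  define D where "D = T + tensor_scale (- 1) S"
  have D: "D \<in> tensors n d" unfolding D_def by (intro tensors_add tensors_scale S T)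
  have ends: "S + tensor_scale 0 D = S" "S + tensor_scale 1 D = T"
    by (auto simp: D_def tensor_scale_def fun_eq_iff)
  obtain p where p: "\<forall>t. P (sym_class n d (S + tensor_scale t D)) = poly p t"
    using sym_poly_fun_on_line[OF P(1) S(1) D] by blast
  obtain q where q: "\<forall>t. Q (sym_class n d (S + tensor_scale t D)) = poly q t"
    using sym_poly_fun_on_line[OF Q(1) S(1) D] by blast
  have "p \<noteq> 0" using P(3) p[rule_format, of 0] unfolding ends(1) S(2) by auto
  moreover have "q \<noteq> 0" using Q(3) q[rule_format, of 1] unfolding ends(2) T(2) by auto
  ultimately have "p * q \<noteq> 0" by simp
  then obtain t where "poly (p * q) t \<noteq> 0" using poly_eq_0_if_vanishes by blast
  then have "P (sym_class n d (S + tensor_scale t D)) * Q (sym_class n d (S + tensor_scale t D)) \<noteq> 0"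
    unfolding p[rule_format] q[rule_format] by simp
  moreover have "sym_class n d (S + tensor_scale t D) \<in> sym_power n d"
    by (intro sym_class_in_sym_power tensors_add tensors_scale S D)
  ultimately show ?thesis by blast
qed

lemma tensors_zero: "0 \<in> tensors n d"
  by (simp add: tensors_def)

lemma common_nonzero:
  fixes P :: "'s \<Rightarrow> 'k::alg_closed_field tensor set \<Rightarrow> 'k"
  assumes "finite S" "\<And>s. s \<in> S \<Longrightarrow> P s \<in> sym_poly_fun n d"
    "\<And>s. s \<in> S \<Longrightarrow> \<exists>f\<in>sym_power n d. P s f \<noteq> 0"
  shows "\<exists>f\<in>sym_power n d. (\<Prod>s\<in>S. P s f) \<noteq> 0"
  using assms
proof (induction S rule: finite_induct)
  case empty
  show ?case using sym_class_in_sym_power[OF tensors_zero] by auto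
next
  case (insert s S)
  then obtain f g where f: "f \<in> sym_power n d" "P s f \<noteq> 0"
    and g: "g \<in> sym_power n d" "(\<Prod>s\<in>S. P s g) \<noteq> 0" by (metis insertCI)
  have "\<exists>h\<in>sym_power n d. P s h * (\<Prod>s\<in>S. P s h) \<noteq> 0"
    by (rule sym_power_irreducible[where P = "P s" and Q = "\<lambda>h. \<Prod>s\<in>S. P s h", OF _ f _ g])
      (use insert.prems in \<open>auto intro: sym_poly_fun_prod\<close>)
  then show ?case using insert.hyps by simp
qed

lemma ex_tensor_with_coefficients:
  fixes x :: "nat multiset \<Rightarrow> 'k::field"
  shows "\<exists>T\<in>tensors n d. \<forall>M\<in>index_msets n d. mset_coeff n d M T = x M"
proof -
  define l where "l M = (SOME xs. mset xs = M)" for M :: "nat multiset"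
  have l: "mset (l M) = M" for M
    unfolding l_def by (rule someI_ex) (rule ex_mset)
  define T where "T = (\<lambda>is. if is \<in> tensor_index n d \<and> is = l (mset is) then x (mset is) else 0)"
  have "mset_coeff n d M T = x M" if M: "M \<in> index_msets n d" for M
  proof -
    have lM: "l M \<in> tensor_index n d"
      using M l[of M] unfolding index_msets_iff tensor_index_def
      by (metis (mono_tags, lifting) mem_Collect_eq set_mset_mset size_mset)
    have "mset_coeff n d M T = (\<Sum>is\<in>{is \<in> tensor_index n d. mset is = M}. if is = l M then x M else 0)"
      unfolding mset_coeff_def by (intro sum.cong) (auto simp: T_def)
    also have "\<dots> = x M"
      using lM l finite_tensor_index[of n d] by simp
    finally show ?thesis .
  qed
  moreover have "T \<in> tensors n d" by (auto simp: T_def tensors_def)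
  ultimately show ?thesis by blast
qed

text \<open>
  One hypersurface for every choice of pivot coordinates \<open>\<rho>\<close>; there are finitely many choices.
\<close>

theorem generic_exclusion_of_unit_tensors:
  assumes d: "d > 0" "\<And>k. d \<noteq> char_exponent TYPE('k::alg_closed_field) ^ k"
    and card: "m * n + m * (2 * m) < card (index_msets m d)"
  shows "\<exists>P\<in>sym_poly_fun n d. (\<exists>f\<in>sym_power n d. P f \<noteq> (0::'k)) \<and>
    (\<forall>f\<in>sym_power n d. P f \<noteq> 0 \<longrightarrow> (\<forall>r\<ge>2 * m.
      unit_sym_tensor r d \<notin> zariski_closure r d {sym_map d A f | A. A \<in> carrier_mat r n}))"
proof -
  define I where "I = index_msets n d"
  have I: "finite I" by (simp add: I_def finite_index_msets)
  define R where "R = {\<rho> \<in> PiE {..<m} (\<lambda>_. {..<n}). inj_on \<rho> {..<m}}"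
  have R: "finite R" by (simp add: R_def finite_PiE)
  define restricts where "restricts \<rho> T \<longleftrightarrow> (\<exists>w \<zeta>. (\<forall>j<m. \<forall>k<m. w j (\<rho> k) = (if k = j then 1 else 0)) \<and>
      (\<forall>z. form n d T (\<lambda>i. \<Sum>j<m. z j * w j i) = (\<Sum>c<2 * m. (\<Sum>j<m. z j * \<zeta> j c) ^ d)))"
    for \<rho> and T :: "'k tensor"
  have "\<forall>\<rho>\<in>R. \<exists>P. P \<in> sym_poly_fun n d \<and> (\<exists>f\<in>sym_power n d. P f \<noteq> 0) \<and>
      (\<forall>T\<in>tensors n d. restricts \<rho> T \<longrightarrow> P (sym_class n d T) = 0)"
  proof
    fix \<rho> assume \<rho>: "\<rho> \<in> R"
    have "inj_on \<rho> {..<m}" "\<rho> ` {..<m} \<subseteq> {..<n}" using \<rho> by (auto simp: R_def)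
    from restricted_power_sums_hypersurface[OF this card, where 'k = 'k]
    obtain D and a :: "(nat multiset \<Rightarrow> nat) \<Rightarrow> 'k" where
      nz: "\<exists>g\<in>PiE I (\<lambda>_. {..D}). a g \<noteq> 0" and
      zero: "\<And>T. restricts \<rho> T \<Longrightarrow>
        (\<Sum>g\<in>PiE I (\<lambda>_. {..D}). a g * (\<Prod>M\<in>I. mset_coeff n d M T ^ g M)) = 0"
      unfolding I_def restricts_def by blast
    define P where "P f = (\<Sum>g\<in>PiE I (\<lambda>_. {..D}). a g * (\<Prod>M\<in>I. class_coeff n d M f ^ g M))" for f
    have P: "P \<in> sym_poly_fun n d"
      unfolding P_def
      by (intro sym_poly_fun_sum sym_poly_fun.mult sym_poly_fun.const sym_poly_fun_prod
          sym_poly_fun_power class_coeff_in_sym_poly_fun)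
    obtain x where x: "(\<Sum>g\<in>PiE I (\<lambda>_. {..D}). a g * (\<Prod>M\<in>I. x M ^ g M)) \<noteq> 0"
      using nz exponent_monomials_independent[OF I, of "\<lambda>_. {..D}" a] by blast
    from ex_tensor_with_coefficients[of n d x, folded I_def]
    obtain T where T: "T \<in> tensors n d" "\<forall>M\<in>I. mset_coeff n d M T = x M" by (elim bexE)
    have "P (sym_class n d T) \<noteq> 0"
      using x T by (simp add: P_def class_coeff_sym_class)
    moreover have "\<forall>T\<in>tensors n d. restricts \<rho> T \<longrightarrow> P (sym_class n d T) = 0"
      using zero by (simp add: P_def class_coeff_sym_class)
    ultimately show "\<exists>P. P \<in> sym_poly_fun n d \<and> (\<exists>f\<in>sym_power n d. P f \<noteq> 0) \<and>
        (\<forall>T\<in>tensors n d. restricts \<rho> T \<longrightarrow> P (sym_class n d T) = 0)"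
      using P sym_class_in_sym_power[OF T(1)] by blast
  qed
  from bchoice[OF this] obtain P where "\<forall>\<rho>\<in>R. P \<rho> \<in> sym_poly_fun n d \<and> (\<exists>f\<in>sym_power n d. P \<rho> f \<noteq> 0) \<and>
      (\<forall>T\<in>tensors n d. restricts \<rho> T \<longrightarrow> P \<rho> (sym_class n d T) = 0)" by (elim exE)
  then have P: "\<And>\<rho>. \<rho> \<in> R \<Longrightarrow> P \<rho> \<in> sym_poly_fun n d"
    "\<And>\<rho>. \<rho> \<in> R \<Longrightarrow> \<exists>f\<in>sym_power n d. P \<rho> f \<noteq> 0"
    "\<And>\<rho> T. \<rho> \<in> R \<Longrightarrow> T \<in> tensors n d \<Longrightarrow> restricts \<rho> T \<Longrightarrow> P \<rho> (sym_class n d T) = 0"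
    by simp_all
  define Q where "Q f = (\<Prod>\<rho>\<in>R. P \<rho> f)" for f
  have "Q \<in> sym_poly_fun n d" unfolding Q_def by (rule sym_poly_fun_prod) (rule P(1))
  moreover have "\<exists>f\<in>sym_power n d. Q f \<noteq> 0"
    unfolding Q_def by (rule common_nonzero[OF R P(1,2)])
  moreover have "Q f = 0"
    if f: "f \<in> sym_power n d" and r: "2 * m \<le> r"
      and closure: "unit_sym_tensor r d \<in> zariski_closure r d {sym_map d A f | A. A \<in> carrier_mat r n}"
    for f r
  proof -
    obtain T where T: "T \<in> tensors n d" "f = sym_class n d T"
      using f by (rule sym_power_obtain)
    from restricted_power_sum_if_degeneration[OF T(1) d r closure[unfolded T(2)]]
    obtain \<rho> w \<zeta> where \<rho>: "inj_on \<rho> {..<m}" "\<rho> ` {..<m} \<subseteq> {..<n}"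
      and w: "\<forall>j<m. \<forall>k<m. w j (\<rho> k) = (if k = j then 1 else 0)"
      and eq: "\<forall>z. form n d T (\<lambda>i. \<Sum>j<m. z j * w j i) = (\<Sum>c<2 * m. (\<Sum>j<m. z j * \<zeta> j c) ^ d)"
      by (elim exE conjE)
    let ?\<rho> = "restrict \<rho> {..<m}"
    have R\<rho>: "?\<rho> \<in> R" using \<rho> by (auto simp: R_def)
    have "restricts ?\<rho> T"
      unfolding restricts_def
      by (rule exI[of _ w], rule exI[of _ \<zeta>]) (use w eq in simp)
    then have "P ?\<rho> f = 0" using P(3)[OF R\<rho> T(1)] T(2) by simp
    then show ?thesis unfolding Q_def using R R\<rho> by (intro prod_zero) auto
  qed
  ultimately show ?thesis by blast
qed

text \<open>
  The value \<open>r = 0\<close> always qualifies, so the maximum is taken over a nonempty finite set.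
\<close>

lemma border_subrank_less:
  fixes f :: "'k::field tensor set"
  assumes d: "d > 0" and f: "f \<in> sym_power n d"
    and excl: "\<And>r. r \<ge> b \<Longrightarrow> unit_sym_tensor r d \<notin> zariski_closure r d {sym_map d A f | A. A \<in> carrier_mat r n}"
  shows "border_subrank n d f < b"
proof -
  let ?S = "{r. unit_sym_tensor r d \<in> zariski_closure r d {sym_map d A f | A. A \<in> carrier_mat r n}}"
  have sub: "?S \<subseteq> {..<b}" using excl not_le by blast
  have "0 \<in> ?S"
  proof -
    obtain T where T: "T \<in> tensors n d" "f = sym_class n d T"
      using f by (rule sym_power_obtain)
    have trivial: "S = 0" if "S \<in> tensors 0 d" for S :: "'k tensor"
      using that d by (auto simp: tensors_def tensor_index_def fun_eq_iff)
    have "tensor_map d (0\<^sub>m 0 n) T = 0"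
      using trivial tensor_map_in_tensors[of d "0\<^sub>m 0 n" T] by simp
    then have "sym_map d (0\<^sub>m 0 n) f = unit_sym_tensor 0 d"
      unfolding T(2) sym_map_class[OF zero_carrier_mat T(1)] unit_sym_tensor_eq
        trivial[OF power_sum_tensor_in_tensors] by (rule arg_cong)
    then have "unit_sym_tensor 0 d \<in> {sym_map d A f | A. A \<in> carrier_mat 0 n}"
      using zero_carrier_mat[of 0 n] by (metis (mono_tags, lifting) mem_Collect_eq)
    moreover have "unit_sym_tensor 0 d \<in> sym_power 0 d"
      unfolding unit_sym_tensor_eq by (intro sym_class_in_sym_power power_sum_tensor_in_tensors)
    ultimately show ?thesis by (auto simp: zariski_closure_def)
  qed
  moreover have "finite ?S" using sub finite_subset by blast
  ultimately have "Max ?S \<in> ?S" by (intro Max_in) auto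
  with sub show ?thesis unfolding border_subrank_def by blast
qed

text \<open>
  If no value of the border subrank were attained on a dense set, then for each value below \<open>2 * m\<close>
  some nonzero polynomial function would vanish where it is attained; the product of these functions
  with the one that excludes larger values would vanish everywhere.
\<close>

theorem generic_border_subrank_less:
  assumes d: "d > 0" "\<And>k. d \<noteq> char_exponent TYPE('k::alg_closed_field) ^ k"
    and card: "m * n + m * (2 * m) < card (index_msets m d)"
  shows "\<exists>r. generic_border_subrank TYPE('k) n d r"
    and "generic_border_subrank TYPE('k) n d r \<Longrightarrow> r < 2 * m"
proof -
  obtain P :: "'k tensor set \<Rightarrow> 'k" and f0 where P: "P \<in> sym_poly_fun n d"
    and f0: "f0 \<in> sym_power n d" "P f0 \<noteq> 0"
    and excl: "\<And>f r. f \<in> sym_power n d \<Longrightarrow> P f \<noteq> 0 \<Longrightarrow> r \<ge> 2 * m \<Longrightarrow>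
      unit_sym_tensor r d \<notin> zariski_closure r d {sym_map d A f | A. A \<in> carrier_mat r n}"
    using generic_exclusion_of_unit_tensors[OF assms] by blast
  have less: "border_subrank n d f < 2 * m" if "f \<in> sym_power n d" "P f \<noteq> 0" for f
    by (rule border_subrank_less[OF d(1) that(1) excl[OF that]])
  let ?X = "\<lambda>r. {f \<in> sym_power n d :: 'k tensor set set. border_subrank n d f = r}"
  show "r < 2 * m" if "generic_border_subrank TYPE('k) n d r"
  proof (rule ccontr)
    assume "\<not> r < 2 * m"
    then have "\<forall>f\<in>?X r. P f = 0" using less by blast
    moreover have "f0 \<in> zariski_closure n d (?X r)"
      using that f0(1) unfolding generic_border_subrank_def zariski_dense_def by simp
    ultimately show False using P f0(2) unfolding zariski_closure_def by blast
  qed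
  show "\<exists>r. generic_border_subrank TYPE('k) n d r"
  proof (rule ccontr)
    assume none: "\<not> ?thesis"
    have "\<forall>r. \<exists>Q. Q \<in> sym_poly_fun n d \<and> (\<exists>f\<in>sym_power n d. Q f \<noteq> 0) \<and> (\<forall>f\<in>?X r. Q f = 0)"
    proof
      fix r
      have "zariski_closure n d (?X r) \<noteq> sym_power n d"
        using none unfolding generic_border_subrank_def zariski_dense_def by blast
      then show "\<exists>Q. Q \<in> sym_poly_fun n d \<and> (\<exists>f\<in>sym_power n d. Q f \<noteq> 0) \<and> (\<forall>f\<in>?X r. Q f = 0)"
        unfolding zariski_closure_def by blast
    qed
    from choice[OF this] obtain Q where "\<forall>r. Q r \<in> sym_poly_fun n d \<and>
        (\<exists>f\<in>sym_power n d. Q r f \<noteq> 0) \<and> (\<forall>f\<in>?X r. Q r f = 0)" by (elim exE)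
    then have Q: "\<And>r. Q r \<in> sym_poly_fun n d" "\<And>r. \<exists>f\<in>sym_power n d. Q r f \<noteq> 0"
      "\<And>r f. f \<in> ?X r \<Longrightarrow> Q r f = 0" by blast+
    define Q' where "Q' = (\<lambda>f. \<Prod>r<2 * m. Q r f)"
    have "Q' \<in> sym_poly_fun n d" unfolding Q'_def by (rule sym_poly_fun_prod) (rule Q(1))
    moreover obtain g where "g \<in> sym_power n d" "Q' g \<noteq> 0"
      unfolding Q'_def using common_nonzero[of "{..<2 * m}" Q n d] Q(1,2) by blast
    ultimately obtain h where h: "h \<in> sym_power n d" "P h * Q' h \<noteq> 0"
      using sym_power_irreducible[OF P f0] by blast
    then have "border_subrank n d h < 2 * m" using less by simp
    moreover have "Q (border_subrank n d h) h = 0" using Q(3) h(1) by blast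
    ultimately have "Q' h = 0" unfolding Q'_def by (intro prod_zero) auto
    with h(2) show False by simp
  qed
qed

text \<open>
  A value of \<open>m\<close> of order \<open>n\<^sup>1\<^sup>/\<^sup>(\<^sup>d\<^sup>-\<^sup>1\<^sup>)\<close> that makes \<open>m\<^sup>d\<^sup>-\<^sup>1\<close> at least \<open>4 * d! * n\<close> and \<open>4 * d! * m\<close>.
\<close>

definition restriction_size :: "nat \<Rightarrow> nat \<Rightarrow> nat"
  where "restriction_size d n = 4 * fact d * (nat \<lfloor>real n powr (1 / (real d - 1))\<rfloor> + 1)"

lemma restriction_size_suffices:
  fixes n d :: nat
  assumes d: "d \<ge> 3"
  defines "m \<equiv> restriction_size d n"
  shows "m * n + m * (2 * m) < card (index_msets m d)"
proof -
  define F b :: nat where "F = fact d" and "b = nat \<lfloor>real n powr (1 / (real d - 1))\<rfloor> + 1"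
  have F: "F \<ge> 1" by (simp add: F_def)
  have b: "b \<ge> 1" by (simp add: b_def)
  have m: "m = 4 * F * b" by (simp add: m_def restriction_size_def F_def b_def)
  have "n \<le> b ^ (d - 1)"
  proof (cases "n = 0")
    case False
    have "real n = (real n powr (1 / (real d - 1))) ^ (d - 1)"
      using False d by (simp add: powr_powr of_nat_diff flip: powr_realpow)
    also have "\<dots> \<le> real b ^ (d - 1)"
      by (rule power_mono) (simp_all add: b_def, linarith)
    finally show ?thesis by (simp flip: of_nat_power)
  qed simp
  moreover have "4 * F \<le> (4 * F) ^ (d - 1)"
    using d F self_le_power[of "4 * F" "d - 1"] by simp
  ultimately have 1: "4 * F * n \<le> m ^ (d - 1)"
    unfolding m power_mult_distrib[of "4 * F"] by (intro mult_mono) auto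
  have "m ^ 2 \<le> m ^ (d - 1)"
    using d F b by (intro power_increasing) (auto simp: m)
  moreover have "4 * F * m \<le> m ^ 2"
    using b by (simp add: m power2_eq_square)
  ultimately have 2: "4 * F * m \<le> m ^ (d - 1)" by simp
  have "m > 0" using F b by (simp add: m)
  then have "m ^ (d - 1) > 0" by simp
  moreover have "F * (n + 2 * m) = F * n + 2 * (F * m)" by (simp add: algebra_simps)
  ultimately have "F * (n + 2 * m) < m ^ (d - 1)"
    using 1 2 unfolding mult.assoc by linarith
  then have "m * (F * (n + 2 * m)) < m * m ^ (d - 1)" using \<open>m > 0\<close> by simp
  also have "\<dots> = m ^ d" using d by (simp flip: power_Suc)
  also have "\<dots> \<le> F * card (index_msets m d)" unfolding F_def by (rule card_index_msets)
  finally have "F * (m * n + m * (2 * m)) < F * card (index_msets m d)" by (simp add: algebra_simps)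
  then show ?thesis by simp
qed

theorem theorem1p5:
  fixes d :: nat
  assumes "\<not> (\<exists>c\<in>{0, 1, 2}. \<exists>k. d = c * char_exponent TYPE('a::alg_closed_field) ^ k)"
  shows "(\<forall>n. \<exists>r. generic_border_subrank TYPE('a) n d r) \<and>
         (\<forall>q. (\<forall>n. generic_border_subrank TYPE('a) n d (q n)) \<longrightarrow>
              (\<lambda>n. real (q n)) \<in> O(\<lambda>n. real n powr (1 / (real d - 1))))"
proof -
  have "d \<noteq> c * char_exponent TYPE('a) ^ k" if "c \<in> {0, 1, 2}" for c k
    using assms that by blast
  from this[of 0] this[of 1] this[of 2 0]
  have pow: "d \<noteq> char_exponent TYPE('a) ^ k" and "d \<noteq> 0" and "d \<noteq> 2" for k by auto
  moreover have "d \<noteq> 1" using pow[of 0] by simp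
  ultimately have d: "d \<ge> 3" "d > 0" by auto
  note bounds = generic_border_subrank_less[OF d(2) pow restriction_size_suffices[OF d(1)]]
  have "(\<lambda>n. real (q n)) \<in> O(\<lambda>n. real n powr (1 / (real d - 1)))"
    if q: "\<forall>n. generic_border_subrank TYPE('a) n d (q n)" for q
  proof (rule bigoI[where c = "16 * fact d"])
    have "norm (real (q n)) \<le> 16 * fact d * norm (real n powr (1 / (real d - 1)))" if "n \<ge> 1" for n
    proof -
      let ?x = "real n powr (1 / (real d - 1))"
      have x: "?x \<ge> 1" using that d by (intro ge_one_powr_ge_zero) auto
      have "real (q n) \<le> real (2 * restriction_size d n)"
        using bounds(2)[of n "q n"] q by (metis less_imp_le of_nat_mono)
      also have "\<dots> = 8 * fact d * (real (nat \<lfloor>?x\<rfloor>) + 1)"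
        by (simp add: restriction_size_def distrib_left)
      also have "\<dots> \<le> 8 * fact d * (?x + ?x)"
        using x by (intro mult_left_mono add_mono) auto
      finally show ?thesis by simp
    qed
    then show "\<forall>\<^sub>F n in at_top. norm (real (q n)) \<le> 16 * fact d * norm (real n powr (1 / (real d - 1)))"
      by (auto simp: eventually_at_top_linorder)
  qed
  with bounds(1) show ?thesis by blast
qed

end
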